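(* If $T:=[T_1,\ldots,T_n]\in B(\mathcal{H})^n$ is any $n$-tuple of operators with joint spectral radius $r(T_1,\ldots,T_n)<1$, then the mapping $\Phi_T:Hol(B(\mathcal{X})^n_1)\to B(\mathcal{H})$ defined by $$\Phi_T(f):=f(T_1,\ldots,T_n)$$ is a continuous unital algebra homomorphism. Moreover, the free analytic functional calculus is uniquely determined by the mapping $Z_i\mapsto T_i$, $i=1,\ldots,n$; that is, any continuous unital algebra homomorphism $\Phi:Hol(B(\mathcal{X})^n_1)\to B(\mathcal{H})$ with $\Phi(Z_i)=T_i$, $i=1,\ldots,n$, equals $\Phi_T$.
   Context: $\mathbb{F}_n^+$ is the unital free semigroup on generators $g_1,\ldots,g_n$ with identity $g_0$; $|\alpha|$ is word length; $T_\alpha:=T_{i_1}\cdots T_{i_k}$ if $\alpha=g_{i_1}\cdots g_{i_k}$, $T_{g_0}:=I$. The joint spectral radius is $r(T_1,\ldots,T_n):=\lim_{k\to\infty}\|\sum_{|\alpha|=k}T_\alpha T_\alpha^*\|^{1/2k}$. $Hol(B(\mathcal{X})^n_1)$ is the algebra (with the noncommutative Cauchy product) of formal power series $f=\sum_\alpha a_\alpha Z_\alpha$, $a_\alpha\in\mathbb{C}$, in noncommuting indeterminates with $\limsup_{k\to\infty}(\sum_{|\alpha|=k}|a_\alpha|^2)^{1/2k}\le1$; $f(X_1,\ldots,X_n):=\sum_{k=0}^\infty\sum_{|\alpha|=k}a_\alpha X_\alpha$ converges in norm when $\|\sum_iX_iX_i^*\|<1$. Free analytic functional calculus: for $r(T_1,\ldots,T_n)<1$,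 $f(T_1,\ldots,T_n):=\sum_{k=0}^\infty\sum_{|\alpha|=k}a_\alpha T_\alpha$, where the series converges in norm. $Hol(B(\mathcal{X})^n_1)$ is topologized by the metric $\rho(f,g):=\sum_{m=1}^\infty2^{-m}\frac{\rho_{r_m}(f,g)}{1+\rho_{r_m}(f,g)}$, where $0<r_m<1$ is a fixed increasing sequence with $r_m\to1$ and $\rho_r(f,g):=\sup\|f(X)-g(X)\|$, the supremum over $n$-tuples $X\in B(\mathcal{E})^n$ with $\|\sum_iX_iX_i^*\|^{1/2}\le r$, $\mathcal{E}$ being an infinite dimensional Hilbert space. $B(\mathcal{H})$ has the operator norm topology. *)

theory Defs
  imports "HOL-Analysis.Analysis"
begin

section \<open>Complex Hilbert spaces\<close>

class scaleC =
  fixes scaleC :: "complex \<Rightarrow> 'a \<Rightarrow> 'a"  (infixr "*\<^sub>C" 75)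

text \<open>
  The inner product is linear in its first argument. Positivity and definiteness are contained in
  the last axiom, because the norm of a \<^class>\<open>banach\<close> space has these properties.
\<close>
class complex_hilbert = banach + scaleC +
  fixes cinner :: "'a \<Rightarrow> 'a \<Rightarrow> complex"
  assumes scaleC_add_right: "c *\<^sub>C (x + y) = c *\<^sub>C x + c *\<^sub>C y"
    and scaleC_add_left: "(c + d) *\<^sub>C x = c *\<^sub>C x + d *\<^sub>C x"
    and scaleC_scaleC: "c *\<^sub>C d *\<^sub>C x = (c * d) *\<^sub>C x"
    and scaleC_one: "1 *\<^sub>C x = x"
    and scaleR_eq_scaleC: "a *\<^sub>R x = complex_of_real a *\<^sub>C x"
    and cinner_commute: "cinner x y = cnj (cinner y x)"
    and cinner_add_left: "cinner (x + y) z = cinner x z + cinner y z"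
    and cinner_scaleC_left: "cinner (c *\<^sub>C x) y = c * cinner x y"
    and cinner_self: "cinner x x = complex_of_real ((norm x)\<^sup>2)"

global_interpretation complex_hilbert: vector_space "scaleC :: complex \<Rightarrow> 'a \<Rightarrow> 'a::complex_hilbert"
  by unfold_locales
    (simp_all add: scaleC_add_right scaleC_add_left scaleC_scaleC scaleC_one)

definition infinite_dimensional :: "'a::complex_hilbert itself \<Rightarrow> bool" where
  "infinite_dimensional _ \<longleftrightarrow>
     \<not> (\<exists>B :: 'a set. finite B \<and> complex_hilbert.span B = UNIV)"

lemma norm_scaleC: "norm (c *\<^sub>C x) = cmod c * norm (x :: 'a::complex_hilbert)"
proof -
  have "cinner (c *\<^sub>C x) (c *\<^sub>C x) = c * cnj (c * cinner x x)"
    by (metis cinner_commute cinner_scaleC_left)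
  also have "\<dots> = complex_of_real ((cmod c * norm x)\<^sup>2)"
    by (simp add: cinner_self power_mult_distrib complex_norm_square[unfolded of_real_power])
  finally have "(norm (c *\<^sub>C x))\<^sup>2 = (cmod c * norm x)\<^sup>2"
    unfolding cinner_self of_real_eq_iff .
  then show ?thesis
    by (simp add: power2_eq_iff_nonneg)
qed

section \<open>Bounded operators\<close>

text \<open>
  \<open>'h \<Rightarrow>\<^sub>L 'h\<close> consists of the bounded \<^emph>\<open>real\<close>-linear maps; the algebra \<open>B(H)\<close> is the subset
  of the complex-linear ones, with the operator norm of \<open>'h \<Rightarrow>\<^sub>L 'h\<close>.
\<close>
definition bounded_operators :: "('h::complex_hilbert \<Rightarrow>\<^sub>L 'h) set" where
  "bounded_operators = {A. \<forall>c x. blinfun_apply A (c *\<^sub>C x) = c *\<^sub>C blinfun_apply A x}"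

instantiation blinfun :: (real_normed_vector, complex_hilbert) scaleC
begin

lift_definition scaleC_blinfun :: "complex \<Rightarrow> 'a \<Rightarrow>\<^sub>L 'b \<Rightarrow> 'a \<Rightarrow>\<^sub>L 'b" is
  "\<lambda>c A x. c *\<^sub>C A x"
proof -
  fix c :: complex and A :: "'a \<Rightarrow> 'b"
  assume A: "bounded_linear A"
  have "bounded_linear (\<lambda>y::'b. c *\<^sub>C y)"
    by (rule bounded_linear_intro[where K = "cmod c"])
      (simp_all add: scaleC_add_right scaleR_eq_scaleC scaleC_scaleC norm_scaleC mult.commute)
  from bounded_linear_compose[OF this A] show "bounded_linear (\<lambda>x. c *\<^sub>C A x)" .
qed

instance ..

end

definition cadjoint :: "('h::complex_hilbert \<Rightarrow>\<^sub>L 'h) \<Rightarrow> ('h \<Rightarrow>\<^sub>L 'h)" where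
  "cadjoint A = (THE B. \<forall>x y. cinner (blinfun_apply A x) y = cinner x (blinfun_apply B y))"

text \<open>
  The index type \<open>'n\<close> plays the role of \<open>{1,\<dots>,n}\<close>; an \<open>n\<close>-tuple of operators is a function on
  \<open>'n\<close> and the free semigroup on \<open>n\<close> generators is \<open>'n list\<close>, with \<open>[]\<close> as its identity.
\<close>
definition op_word :: "('n \<Rightarrow> 'h::complex_hilbert \<Rightarrow>\<^sub>L 'h) \<Rightarrow> 'n list \<Rightarrow> ('h \<Rightarrow>\<^sub>L 'h)" where
  "op_word T \<alpha> = foldr (\<lambda>i A. T i o\<^sub>L A) \<alpha> id_blinfun"

definition joint_spectral_radius :: "('n::finite \<Rightarrow> 'h::complex_hilbert \<Rightarrow>\<^sub>L 'h) \<Rightarrow> real" where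
  "joint_spectral_radius T =
     lim (\<lambda>k. root (2 * k)
       (norm (\<Sum>\<alpha> | length \<alpha> = k. op_word T \<alpha> o\<^sub>L cadjoint (op_word T \<alpha>))))"

section \<open>Free holomorphic functions\<close>

text \<open>A formal power series in noncommuting indeterminates is its family of coefficients.\<close>

type_synonym 'n nc_series = "'n list \<Rightarrow> complex"

definition nc_one :: "'n nc_series" where
  "nc_one = (\<lambda>\<alpha>. if \<alpha> = [] then 1 else 0)"

definition nc_var :: "'n \<Rightarrow> 'n nc_series" where
  "nc_var i = (\<lambda>\<alpha>. if \<alpha> = [i] then 1 else 0)"

definition nc_add :: "'n nc_series \<Rightarrow> 'n nc_series \<Rightarrow> 'n nc_series" where
  "nc_add f g = (\<lambda>\<alpha>. f \<alpha> + g \<alpha>)"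

definition nc_scale :: "complex \<Rightarrow> 'n nc_series \<Rightarrow> 'n nc_series" where
  "nc_scale c f = (\<lambda>\<alpha>. c * f \<alpha>)"

definition nc_mult :: "'n nc_series \<Rightarrow> 'n nc_series \<Rightarrow> 'n nc_series" where
  "nc_mult f g = (\<lambda>\<alpha>. \<Sum>(\<beta>, \<gamma>) | \<beta> @ \<gamma> = \<alpha>. f \<beta> * g \<gamma>)"

definition Hol :: "('n::finite) nc_series set" where
  "Hol = {f. limsup (\<lambda>k. ereal (root (2 * k) (\<Sum>\<alpha> | length \<alpha> = k. (cmod (f \<alpha>))\<^sup>2))) \<le> 1}"

definition nc_eval ::
    "('n::finite) nc_series \<Rightarrow> ('n \<Rightarrow> 'h::complex_hilbert \<Rightarrow>\<^sub>L 'h) \<Rightarrow> ('h \<Rightarrow>\<^sub>L 'h)" where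
  "nc_eval f T = (\<Sum>k. \<Sum>\<alpha> | length \<alpha> = k. f \<alpha> *\<^sub>C op_word T \<alpha>)"

definition row_ball :: "real \<Rightarrow> ('n::finite \<Rightarrow> 'e::complex_hilbert \<Rightarrow>\<^sub>L 'e) set" where
  "row_ball s = {X. (\<forall>i. X i \<in> bounded_operators) \<and>
                    sqrt (norm (\<Sum>i\<in>UNIV. X i o\<^sub>L cadjoint (X i))) \<le> s}"

definition hol_sup_dist ::
    "'e::complex_hilbert itself \<Rightarrow> real \<Rightarrow> ('n::finite) nc_series \<Rightarrow> 'n nc_series \<Rightarrow> real" where
  "hol_sup_dist _ s f g =
     (SUP X \<in> (row_ball s :: ('n \<Rightarrow> 'e \<Rightarrow>\<^sub>L 'e) set). norm (nc_eval f X - nc_eval g X))"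

text \<open>
  The sequence \<open>r\<close> is indexed from \<open>0\<close>, so \<open>r m\<close> is the radius that carries the weight
  \<open>(1/2) ^ Suc m\<close>. The value \<open>0\<close> off \<^term>\<open>Hol\<close> is a convention only: the locale
  \<^locale>\<open>Metric_space\<close> asks for nonnegativity and symmetry outside the carrier as well.
\<close>
definition hol_dist ::
    "'e::complex_hilbert itself \<Rightarrow> (nat \<Rightarrow> real) \<Rightarrow> ('n::finite) nc_series \<Rightarrow> 'n nc_series \<Rightarrow> real"
  where
  "hol_dist E r f g =
     (if f \<in> Hol \<and> g \<in> Hol
      then \<Sum>m. (1/2) ^ Suc m * (hol_sup_dist E (r m) f g / (1 + hol_sup_dist E (r m) f g))
      else 0)"

definition Hol_topology ::
    "'e::complex_hilbert itself \<Rightarrow> (nat \<Rightarrow> real) \<Rightarrow> ('n::finite) nc_series topology" where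
  "Hol_topology E r = Metric_space.mtopology Hol (hol_dist E r)"

definition unital_algebra_hom ::
    "(('n::finite) nc_series \<Rightarrow> ('h::complex_hilbert \<Rightarrow>\<^sub>L 'h)) \<Rightarrow> bool" where
  "unital_algebra_hom \<Phi> \<longleftrightarrow>
     (\<forall>f\<in>Hol. \<Phi> f \<in> bounded_operators) \<and>
     (\<forall>f\<in>Hol. \<forall>g\<in>Hol. \<Phi> (nc_add f g) = \<Phi> f + \<Phi> g) \<and>
     (\<forall>c. \<forall>f\<in>Hol. \<Phi> (nc_scale c f) = c *\<^sub>C \<Phi> f) \<and>
     (\<forall>f\<in>Hol. \<forall>g\<in>Hol. \<Phi> (nc_mult f g) = \<Phi> f o\<^sub>L \<Phi> g) \<and>
     \<Phi> nc_one = id_blinfun"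

definition continuous_unital_algebra_hom ::
    "'e::complex_hilbert itself \<Rightarrow> (nat \<Rightarrow> real) \<Rightarrow>
     (('n::finite) nc_series \<Rightarrow> ('h::complex_hilbert \<Rightarrow>\<^sub>L 'h)) \<Rightarrow> bool" where
  "continuous_unital_algebra_hom E r \<Phi> \<longleftrightarrow>
     unital_algebra_hom \<Phi> \<and>
     continuous_map (Hol_topology E r) (top_of_set bounded_operators) \<Phi>"

end

theory Submission
  imports Defs
begin

text \<open>
  Write \<open>\<parallel>f\<parallel>\<^sub>k\<close> for the \<open>\<ell>\<^sup>2\<close> norm of the coefficients of \<open>f\<close> of degree \<open>k\<close>. The degree \<open>k\<close> part of
  \<open>f(T)\<close> is a row operator applied to a column of scalars, so its norm is at most \<open>\<parallel>f\<parallel>\<^sub>k\<close> times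
  the square root of the norm of \<open>\<Sum> T\<^sub>\<alpha> T\<^sub>\<alpha>*\<close> over \<open>\<bar>\<alpha>\<bar> = k\<close>; these norms are
  submultiplicative, hence bounded by \<open>C q\<^sup>k\<close> with \<open>q < 1\<close> when the joint spectral radius is below
  \<open>1\<close>. Conversely, evaluating at \<open>s\<close> times the left creation operators, truncated to finitely many
  words so that they act on any infinite dimensional space, gives the Cauchy estimate
  \<open>\<parallel>f\<parallel>\<^sub>k s\<^sup>k \<le> \<rho>\<^sub>s(f, 0)\<close>. Choosing \<open>s\<close> between \<open>q\<close> and \<open>1\<close> shows that \<open>f \<mapsto> f(T)\<close> is Lipschitz
  with respect to \<open>\<rho>\<^sub>s\<close>. Uniqueness holds because the truncations of \<open>f\<close> are polynomials that
  converge to \<open>f\<close> in the metric.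
\<close>

section \<open>Inner products and adjoints\<close>

lemma cinner_zero_left [simp]: "cinner 0 y = 0"
  for y :: "'a::complex_hilbert"
  using cinner_scaleC_left[of 0 0 y] by simp

lemma cinner_zero_right [simp]: "cinner x 0 = 0"
  for x :: "'a::complex_hilbert"
  using cinner_commute[of x 0] by simp

lemma cinner_add_right: "cinner x (y + z) = cinner x y + cinner x z"
  for x :: "'a::complex_hilbert"
  by (metis cinner_add_left cinner_commute complex_cnj_add)

lemma cinner_scaleC_right: "cinner x (c *\<^sub>C y) = cnj c * cinner x y"
  for x :: "'a::complex_hilbert"
  by (metis cinner_commute cinner_scaleC_left complex_cnj_mult)

lemma cinner_minus_left: "cinner (- x) y = - cinner x y"
  for x :: "'a::complex_hilbert"
  using cinner_add_left[of "- x" x y] by (simp add: eq_neg_iff_add_eq_0)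

lemma cinner_minus_right: "cinner x (- y) = - cinner x y"
  for x :: "'a::complex_hilbert"
  using cinner_add_right[of x "- y" y] by (simp add: eq_neg_iff_add_eq_0)

lemma cinner_diff_left: "cinner (x - y) z = cinner x z - cinner y z"
  for x :: "'a::complex_hilbert"
  using cinner_add_left[of x "- y" z] by (simp add: cinner_minus_left)

lemma cinner_diff_right: "cinner x (y - z) = cinner x y - cinner x z"
  for x :: "'a::complex_hilbert"
  using cinner_add_right[of x y "- z"] by (simp add: cinner_minus_right)

lemma cinner_sum_left: "cinner (\<Sum>i\<in>I. f i) y = (\<Sum>i\<in>I. cinner (f i) y)"
  for y :: "'a::complex_hilbert"
  by (induction I rule: infinite_finite_induct) (simp_all add: cinner_add_left)

lemma cinner_sum_right: "cinner x (\<Sum>i\<in>I. f i) = (\<Sum>i\<in>I. cinner x (f i))"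
  for x :: "'a::complex_hilbert"
  by (induction I rule: infinite_finite_induct) (simp_all add: cinner_add_right)

lemma cinner_scaleR_left: "cinner (a *\<^sub>R x) y = of_real a * cinner x y"
  for x :: "'a::complex_hilbert"
  by (simp add: scaleR_eq_scaleC cinner_scaleC_left)

lemma cinner_scaleR_right: "cinner x (a *\<^sub>R y) = of_real a * cinner x y"
  for x :: "'a::complex_hilbert"
  by (simp add: scaleR_eq_scaleC cinner_scaleC_right)

lemma power2_norm_eq_cinner: "(norm x)\<^sup>2 = Re (cinner x x)"
  for x :: "'a::complex_hilbert"
  by (simp add: cinner_self)

lemma power2_norm_add: "(norm (x + y))\<^sup>2 = (norm x)\<^sup>2 + 2 * Re (cinner x y) + (norm y)\<^sup>2"
  for x :: "'a::complex_hilbert"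
proof -
  have "Re (cinner y x) = Re (cinner x y)"
    by (subst cinner_commute) simp
  then show ?thesis
    by (simp add: power2_norm_eq_cinner cinner_add_left cinner_add_right)
qed

lemma cinner_eqI:
  fixes u v :: "'a::complex_hilbert"
  assumes "\<And>x. cinner x u = cinner x v"
  shows "u = v"
proof -
  have "cinner (u - v) (u - v) = 0"
    using assms[of "u - v"] by (simp add: cinner_diff_right)
  then show ?thesis
    by (simp add: cinner_self)
qed

text \<open>Families are indexed rather than given as sets of vectors because words serve as indices
  below.\<close>

definition orthonormal_on :: "'i set \<Rightarrow> ('i \<Rightarrow> 'a::complex_hilbert) \<Rightarrow> bool" where
  "orthonormal_on A e \<longleftrightarrow> (\<forall>a\<in>A. \<forall>b\<in>A. cinner (e a) (e b) = (if a = b then 1 else 0))"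

lemma norm_orthonormal_sum:
  assumes "finite A" and "orthonormal_on A e"
  shows "(norm (\<Sum>a\<in>A. c a *\<^sub>C e a))\<^sup>2 = (\<Sum>a\<in>A. (cmod (c a))\<^sup>2)"
proof -
  have "cinner (\<Sum>a\<in>A. c a *\<^sub>C e a) (\<Sum>a\<in>A. c a *\<^sub>C e a)
      = (\<Sum>a\<in>A. \<Sum>b\<in>A. c b * (cnj (c a) * cinner (e b) (e a)))"
    by (simp add: cinner_sum_left cinner_sum_right cinner_scaleC_left cinner_scaleC_right sum_distrib_left
        mult.left_commute)
  also have "\<dots> = (\<Sum>a\<in>A. \<Sum>b\<in>A. if b = a then c a * cnj (c a) else 0)"
    using assms(2) unfolding orthonormal_on_def by (intro sum.cong refl) auto
  also have "\<dots> = (\<Sum>a\<in>A. c a * cnj (c a))"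
    using assms(1) by (intro sum.cong refl) simp
  also have "\<dots> = of_real (\<Sum>a\<in>A. (cmod (c a))\<^sup>2)"
    by (simp only: of_real_sum complex_norm_square)
  finally show ?thesis
    unfolding cinner_self of_real_eq_iff .
qed

lemma cinner_orthonormal_sum:
  assumes "finite A" and "orthonormal_on A e" and "b \<in> A"
  shows "cinner (\<Sum>a\<in>A. c a *\<^sub>C e a) (e b) = c b"
proof -
  have "cinner (\<Sum>a\<in>A. c a *\<^sub>C e a) (e b) = (\<Sum>a\<in>A. if a = b then c b else 0)"
    using assms(2,3) unfolding orthonormal_on_def cinner_sum_left cinner_scaleC_left
    by (intro sum.cong refl) auto
  then show ?thesis
    using assms(1,3) by simp
qed

text \<open>The vector \<open>p\<close> is the orthogonal projection of \<open>x\<close> onto the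
  span of the family; \<open>x - p\<close> is orthogonal to \<open>p\<close>, and Pythagoras
  applies.\<close>

lemma Bessel_inequality:
  assumes "finite A" and "orthonormal_on A e"
  shows "(\<Sum>a\<in>A. (cmod (cinner x (e a)))\<^sup>2) \<le> (norm x)\<^sup>2"
proof -
  define p where "p = (\<Sum>a\<in>A. cinner x (e a) *\<^sub>C e a)"
  have "cinner (x - p) p = (\<Sum>a\<in>A. cnj (cinner x (e a)) * cinner (x - p) (e a))"
    unfolding p_def by (simp add: cinner_sum_right cinner_scaleC_right)
  also have "\<dots> = 0"
    using cinner_orthonormal_sum[OF assms] by (intro sum.neutral) (simp add: p_def cinner_diff_left)
  finally have "(norm x)\<^sup>2 = (norm (x - p))\<^sup>2 + (norm p)\<^sup>2"
    using power2_norm_add[of "x - p" p] by simp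
  then show ?thesis
    using norm_orthonormal_sum[OF assms, of "\<lambda>a. cinner x (e a)"] by (simp add: p_def)
qed

text \<open>Bessel's inequality for the one-element family consisting of \<open>y\<close>
  normalised.\<close>

lemma Cauchy_Schwarz: "cmod (cinner x y) \<le> norm x * norm y"
  for x :: "'a::complex_hilbert"
proof (cases "y = 0")
  case False
  define e where "e = (1 / norm y) *\<^sub>R y"
  have "cinner e e = 1"
    using False by (simp add: e_def cinner_self)
  then have "(cmod (cinner x e))\<^sup>2 \<le> (norm x)\<^sup>2"
    using Bessel_inequality[of "{()}" "\<lambda>_. e" x] by (simp add: orthonormal_on_def)
  then have "cmod (cinner x e) \<le> norm x"
    by (rule power2_le_imp_le) simp
  then show ?thesis
    using False by (simp add: e_def cinner_scaleR_right norm_divide pos_divide_le_eq)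
qed simp

text \<open>First-order condition at a minimum, without derivatives. With \<open>t = - c\<close> the
  expression becomes \<open>- (a + 2)\<close> times the square of \<open>c\<close>; the shift
  \<open>a + 1\<close> in the denominator also covers \<open>a = 0\<close>.\<close>

lemma quadratic_nonneg_imp_linear_coeff_zero:
  fixes a b :: real
  assumes "a \<ge> 0" and "\<And>t. t\<^sup>2 * a + 2 * t * b \<ge> 0"
  shows "b = 0"
proof -
  define c where "c = b / (a + 1)"
  have b: "b = c * (a + 1)"
    using assms(1) by (simp add: c_def)
  have "c\<^sup>2 * (a + 2) \<le> 0"
    using assms(2)[of "- c"] unfolding b by (simp add: power2_eq_square algebra_simps)
  with assms(1) have "c = 0"
    by (auto simp: mult_le_0_iff)
  with b show ?thesis
    by simp
qed

text \<open>The representing vector minimises \<open>\<parallel>x\<parallel>\<^sup>2 - 2 Re (\<phi> x)\<close>.\<close>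
lemma Riesz_representation:
  fixes \<phi> :: "'a::complex_hilbert \<Rightarrow> complex"
  assumes add: "\<And>x y. \<phi> (x + y) = \<phi> x + \<phi> y"
    and scale: "\<And>c x. \<phi> (c *\<^sub>C x) = c * \<phi> x"
    and bound: "\<And>x. cmod (\<phi> x) \<le> K * norm x"
  obtains z where "\<And>x. \<phi> x = cinner x z"
proof -
  define J where "J x = (norm x)\<^sup>2 - 2 * Re (\<phi> x)" for x
  have scaleR: "\<phi> (a *\<^sub>R x) = of_real a * \<phi> x" for a x
    by (simp add: scaleR_eq_scaleC scale)
  have \<phi>_lin: "bounded_linear \<phi>"
    by (rule bounded_linear_intro[where K = K])
      (use add scaleR bound in \<open>simp_all add: scaleR_conv_of_real mult.commute\<close>)
  \<comment> \<open>Completing the square; without this bound the infimum \<open>m\<close> would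
    have no meaning.\<close>
  have J_lower: "J x \<ge> - K\<^sup>2" for x
  proof -
    have "Re (\<phi> x) \<le> K * norm x"
      using bound[of x] complex_Re_le_cmod[of "\<phi> x"] by linarith
    moreover have "0 \<le> (norm x - K)\<^sup>2"
      by simp
    ultimately show ?thesis
      unfolding J_def by (simp add: power2_diff mult.commute[of K])
  qed
  define m where "m = (INF x. J x)"
  have m_le: "m \<le> J x" for x
    unfolding m_def by (rule cINF_lower) (use J_lower in \<open>auto intro!: bdd_belowI\<close>)
  have "\<exists>x. J x < m + 1 / real (Suc n)" for n
  proof -
    have "(INF x. J x) < m + 1 / real (Suc n)"
      unfolding m_def by simp
    then show ?thesis
      by (subst (asm) cINF_less_iff) (use J_lower in \<open>auto intro!: bdd_belowI\<close>)
  qed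
  then obtain s where s: "\<And>n. J (s n) < m + 1 / real (Suc n)"
    by metis
  \<comment> \<open>The \<open>\<phi>\<close> terms cancel by additivity, leaving the parallelogram
    law. Since \<open>J\<close> is at least \<open>m\<close> at the midpoint, near-minimisers are
    close together, so the minimising sequence is Cauchy.\<close>
  have parallelogram: "(norm (x - y))\<^sup>2 = 2 * J x + 2 * J y - 4 * J ((1/2) *\<^sub>R (x + y))" for x y
  proof -
    have "J ((1/2) *\<^sub>R (x + y)) = (norm (x + y))\<^sup>2 / 4 - Re (\<phi> x) - Re (\<phi> y)"
      unfolding J_def scaleR norm_scaleR power_mult_distrib by (simp add: add power2_eq_square field_simps)
    then show ?thesis
      using power2_norm_add[of x y] power2_norm_add[of x "- y"]
      by (simp add: J_def[of x] J_def[of y] cinner_minus_right field_simps)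
  qed
  have s_close: "(norm (s i - s j))\<^sup>2 < 4 / real (Suc n)" if "n \<le> i" "n \<le> j" for i j n
  proof -
    have "1 / real (Suc i) \<le> 1 / real (Suc n)" "1 / real (Suc j) \<le> 1 / real (Suc n)"
      using that by (auto intro!: divide_left_mono)
    moreover have "4 / real (Suc n) = 4 * (1 / real (Suc n))"
      by simp
    ultimately show ?thesis
      using parallelogram[of "s i" "s j"] s[of i] s[of j] m_le[of "(1/2) *\<^sub>R (s i + s j)"]
      by linarith
  qed
  have "Cauchy s"
  proof (rule metric_CauchyI)
    fix \<epsilon> :: real
    assume "\<epsilon> > 0"
    then obtain n where n: "4 / \<epsilon>\<^sup>2 < real n"
      using reals_Archimedean2 by blast
    have "(norm (s i - s j))\<^sup>2 < \<epsilon>\<^sup>2" if "n \<le> i" "n \<le> j" for i j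
    proof -
      have "4 / real (Suc n) < \<epsilon>\<^sup>2"
        using n \<open>\<epsilon> > 0\<close> by (simp add: field_simps) (smt (verit) zero_less_power)
      then show ?thesis
        using s_close[OF that] by linarith
    qed
    then show "\<exists>M. \<forall>m\<ge>M. \<forall>n\<ge>M. dist (s m) (s n) < \<epsilon>"
      using \<open>\<epsilon> > 0\<close> unfolding dist_norm by (meson less_imp_le power2_less_imp_less)
  qed
  then obtain z where z: "s \<longlonglongrightarrow> z"
    using Cauchy_convergent_iff convergent_def by blast
  have "(\<lambda>n. J (s n)) \<longlonglongrightarrow> J z"
    unfolding J_def using z by (intro tendsto_intros bounded_linear.tendsto[OF \<phi>_lin])
  moreover have "(\<lambda>n. m + 1 / real (Suc n)) \<longlonglongrightarrow> m + 0"
    by (intro tendsto_intros LIMSEQ_Suc[OF lim_1_over_n])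
  ultimately have Jz: "J z \<le> m"
    using s by (intro LIMSEQ_le[of "\<lambda>n. J (s n)" _ "\<lambda>n. m + 1 / real (Suc n)"])
      (auto intro!: exI[of _ 0] less_imp_le)
  \<comment> \<open>First variation: \<open>z\<close> minimises \<open>J\<close>, so the linear
    coefficient of \<open>J (z + t *\<^sub>R v)\<close> in \<open>t\<close> vanishes.\<close>
  have Re_eq: "Re (cinner z v) = Re (\<phi> v)" for v
  proof -
    have "Re (cinner z v) - Re (\<phi> v) = 0"
    proof (rule quadratic_nonneg_imp_linear_coeff_zero[of "(norm v)\<^sup>2"])
      fix t :: real
      have "J z \<le> J (z + t *\<^sub>R v)"
        using Jz m_le by (rule order_trans)
      then show "0 \<le> t\<^sup>2 * (norm v)\<^sup>2 + 2 * t * (Re (cinner z v) - Re (\<phi> v))"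
        unfolding J_def power2_norm_add
        by (simp add: cinner_scaleR_right add scaleR power_mult_distrib algebra_simps)
    qed simp
    then show ?thesis by simp
  qed
  have "\<phi> x = cinner x z" for x
  proof (rule complex_eqI)
    show "Re (\<phi> x) = Re (cinner x z)"
      using Re_eq[of x] by (subst cinner_commute) simp
    show "Im (\<phi> x) = Im (cinner x z)"
      \<comment> \<open>Real parts agree at every vector; applying this to
        \<open>\<i> *\<^sub>C x\<close> recovers the imaginary parts.\<close>
      using Re_eq[of "\<i> *\<^sub>C x"]
      by (subst cinner_commute) (simp add: scale cinner_scaleC_right)
  qed
  then show ?thesis ..
qed

text \<open>Definiteness of the inner product leaves at most one candidate for the definite
  description in \<open>cadjoint\<close>, so adjoints can be computed by exhibiting one.\<close>

lemma cadjoint_unique: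
  fixes A B :: "'h::complex_hilbert \<Rightarrow>\<^sub>L 'h"
  assumes "\<And>x y. cinner (A x) y = cinner x (B y)"
  shows "cadjoint A = B"
  unfolding cadjoint_def
proof (rule the_equality)
  fix C :: "'h \<Rightarrow>\<^sub>L 'h"
  assume "\<forall>x y. cinner (A x) y = cinner x (C y)"
  with assms show "C = B"
    by (intro blinfun_eqI cinner_eqI) metis
qed (use assms in blast)

text \<open>Existence of the adjoint. Complex linearity of \<open>A\<close> makes
  \<open>x \<mapsto> cinner (A x) y\<close> a functional to which Riesz applies, and the
  representing vector is \<open>B y\<close>. Taking \<open>x = B y\<close> bounds \<open>B\<close>
  by \<open>norm A\<close>.\<close>

lemma cinner_cadjoint:
  fixes A :: "'h::complex_hilbert \<Rightarrow>\<^sub>L 'h"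
  assumes A: "A \<in> bounded_operators"
  shows "cinner (A x) y = cinner x (cadjoint A y)"
proof -
  have "\<exists>z. \<forall>x. cinner (A x) y = cinner x z" for y
  proof (rule Riesz_representation)
    show "cmod (cinner (A x) y) \<le> (norm A * norm y) * norm x" for x
    proof -
      have "cmod (cinner (A x) y) \<le> norm (A x) * norm y"
        by (rule Cauchy_Schwarz)
      also have "\<dots> \<le> (norm A * norm x) * norm y"
        by (intro mult_right_mono norm_blinfun) simp
      finally show ?thesis
        by (simp add: mult_ac)
    qed
  qed (use A in \<open>auto simp: bounded_operators_def blinfun.add_right cinner_add_left cinner_scaleC_left\<close>)
  then obtain B where B: "\<And>x y. cinner (A x) y = cinner x (B y)"
    by metis
  have "bounded_linear B"
  proof (rule bounded_linear_intro[where K = "norm A"])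
    show "B (x + y) = B x + B y" for x y
      by (rule cinner_eqI) (simp add: cinner_add_right flip: B)
    show "B (a *\<^sub>R x) = a *\<^sub>R B x" for a x
      by (rule cinner_eqI) (simp add: cinner_scaleR_right flip: B)
    show "norm (B y) \<le> norm y * norm A" for y
    proof (cases "B y = 0")
      case False
      have "(norm (B y))\<^sup>2 = cmod (cinner (A (B y)) y)"
        by (simp add: B cinner_self norm_power)
      also have "\<dots> \<le> norm (A (B y)) * norm y"
        by (rule Cauchy_Schwarz)
      also have "\<dots> \<le> (norm A * norm (B y)) * norm y"
        by (intro mult_right_mono norm_blinfun) simp
      finally show ?thesis
        using False by (simp add: power2_eq_square mult_ac)
    qed simp
  qed
  then have "cadjoint A = Blinfun B"
    by (intro cadjoint_unique) (simp add: B bounded_linear_Blinfun_apply)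
  with \<open>bounded_linear B\<close> show ?thesis
    by (simp add: B bounded_linear_Blinfun_apply)
qed

section \<open>Row operators\<close>

lemma id_blinfun_bounded_operators [simp]: "id_blinfun \<in> bounded_operators"
  by (simp add: bounded_operators_def)

lemma blinfun_compose_bounded_operators:
  "A \<in> bounded_operators \<Longrightarrow> B \<in> bounded_operators \<Longrightarrow> A o\<^sub>L B \<in> bounded_operators"
  by (simp add: bounded_operators_def)

lemma bounded_operators_zero [simp]: "0 \<in> bounded_operators"
  by (simp add: bounded_operators_def)

lemma bounded_operators_sum:
  "(\<And>i. i \<in> I \<Longrightarrow> A i \<in> bounded_operators) \<Longrightarrow> (\<Sum>i\<in>I. A i) \<in> bounded_operators"
  by (simp add: bounded_operators_def blinfun.sum_left complex_hilbert.scale_sum_right)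

lemma bounded_operators_scaleC:
  "A \<in> bounded_operators \<Longrightarrow> c *\<^sub>C A \<in> bounded_operators"
  by (simp add: bounded_operators_def scaleC_blinfun.rep_eq scaleC_scaleC mult.commute)

lemma bounded_linear_scaleC: "bounded_linear (\<lambda>x :: 'a::complex_hilbert. c *\<^sub>C x)"
  by (rule bounded_linear_intro[where K = "cmod c"])
    (simp_all add: scaleC_add_right scaleR_eq_scaleC scaleC_scaleC norm_scaleC mult.commute)

text \<open>Complex linearity is a family of equations between evaluations, which are continuous in
  \<open>A\<close>. It therefore survives the norm limits that define \<open>f(T)\<close>.\<close>

lemma closed_bounded_operators: "closed (bounded_operators :: ('h::complex_hilbert \<Rightarrow>\<^sub>L 'h) set)"
proof -
  have "closed {A :: 'h \<Rightarrow>\<^sub>L 'h. A (c *\<^sub>C x) = c *\<^sub>C A x}" for c x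
    by (intro closed_Collect_eq continuous_intros
        bounded_linear.continuous_on[OF bounded_linear_scaleC])
  then show ?thesis
    unfolding bounded_operators_def by (intro closed_Collect_all)
qed

lemma cadjoint_blinfun_compose:
  fixes A B :: "'h::complex_hilbert \<Rightarrow>\<^sub>L 'h"
  assumes "A \<in> bounded_operators" and "B \<in> bounded_operators"
  shows "cadjoint (A o\<^sub>L B) = cadjoint B o\<^sub>L cadjoint A"
  using assms by (intro cadjoint_unique) (simp add: cinner_cadjoint)

lemma cadjoint_id_blinfun [simp]: "cadjoint id_blinfun = id_blinfun"
  by (intro cadjoint_unique) simp

lemma L2_set_power2: "(L2_set f A)\<^sup>2 = (\<Sum>i\<in>A. (f i)\<^sup>2)"
  by (simp add: L2_set_def sum_nonneg)

text \<open>The left side is the quadratic form of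
  \<open>\<Sum>i\<in>I. A i o\<^sub>L cadjoint (A i)\<close> at \<open>y\<close>. Together with the
  next lemma this identifies the norm of that sum as the squared norm of the column of adjoints,
  without forming a direct sum of Hilbert spaces.\<close>

lemma sum_power2_norm_cadjoint_le:
  fixes A :: "'i \<Rightarrow> 'h::complex_hilbert \<Rightarrow>\<^sub>L 'h"
  assumes "\<And>i. i \<in> I \<Longrightarrow> A i \<in> bounded_operators"
  shows "(\<Sum>i\<in>I. (norm (cadjoint (A i) y))\<^sup>2) \<le> norm (\<Sum>i\<in>I. A i o\<^sub>L cadjoint (A i)) * (norm y)\<^sup>2"
proof -
  have "cinner ((\<Sum>i\<in>I. A i o\<^sub>L cadjoint (A i)) y) y = (\<Sum>i\<in>I. cinner (cadjoint (A i) y) (cadjoint (A i) y))"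
    unfolding blinfun.sum_left cinner_sum_left using assms by (simp add: cinner_cadjoint)
  then have "(\<Sum>i\<in>I. (norm (cadjoint (A i) y))\<^sup>2) = Re (cinner ((\<Sum>i\<in>I. A i o\<^sub>L cadjoint (A i)) y) y)"
    by (simp add: cinner_self)
  also have "\<dots> \<le> norm ((\<Sum>i\<in>I. A i o\<^sub>L cadjoint (A i)) y) * norm y"
    using complex_Re_le_cmod Cauchy_Schwarz by (rule order_trans)
  also have "\<dots> \<le> norm (\<Sum>i\<in>I. A i o\<^sub>L cadjoint (A i)) * norm y * norm y"
    by (intro mult_right_mono norm_blinfun) simp
  finally show ?thesis
    by (simp add: power2_eq_square mult.assoc)
qed

lemma norm_sum_compose_cadjoint_le:
  fixes A :: "'i \<Rightarrow> 'h::complex_hilbert \<Rightarrow>\<^sub>L 'h"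
  assumes A: "\<And>i. i \<in> I \<Longrightarrow> A i \<in> bounded_operators"
    and "c \<ge> 0"
    and c: "\<And>y. (\<Sum>i\<in>I. (norm (cadjoint (A i) y))\<^sup>2) \<le> c * (norm y)\<^sup>2"
  shows "norm (\<Sum>i\<in>I. A i o\<^sub>L cadjoint (A i)) \<le> c"
proof (rule norm_blinfun_bound)
  fix x
  define y where "y = (\<Sum>i\<in>I. A i o\<^sub>L cadjoint (A i)) x"
  have L2: "L2_set (\<lambda>i. norm (cadjoint (A i) z)) I \<le> sqrt c * norm z" for z
    unfolding L2_set_def using real_sqrt_le_mono[OF c[of z]] by (simp add: real_sqrt_mult)
  have "cinner y z = (\<Sum>i\<in>I. cinner (cadjoint (A i) x) (cadjoint (A i) z))" for z
    unfolding y_def blinfun.sum_left cinner_sum_left using A by (simp add: cinner_cadjoint)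
  then have "(norm y)\<^sup>2 = cmod (\<Sum>i\<in>I. cinner (cadjoint (A i) x) (cadjoint (A i) y))"
    by (metis cinner_self norm_of_real abs_power2)
  also have "\<dots> \<le> (\<Sum>i\<in>I. norm (cadjoint (A i) x) * norm (cadjoint (A i) y))"
    by (intro sum_norm_le Cauchy_Schwarz)
  also have "\<dots> \<le> L2_set (\<lambda>i. norm (cadjoint (A i) x)) I * L2_set (\<lambda>i. norm (cadjoint (A i) y)) I"
    using L2_set_mult_ineq[of "\<lambda>i. norm (cadjoint (A i) x)" "\<lambda>i. norm (cadjoint (A i) y)" I] by simp
  also have "\<dots> \<le> (sqrt c * norm x) * (sqrt c * norm y)"
    by (intro mult_mono L2) (auto simp: L2_set_nonneg \<open>c \<ge> 0\<close>)
  also have "\<dots> = (sqrt c * sqrt c) * norm x * norm y"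
    by (simp only: mult_ac)
  also have "\<dots> = c * norm x * norm y"
    using \<open>c \<ge> 0\<close> by simp
  finally have "norm y * norm y \<le> (c * norm x) * norm y"
    by (simp add: power2_eq_square)
  then show "norm y \<le> c * norm x"
    using \<open>c \<ge> 0\<close> by (cases "norm y = 0") (auto simp: mult_le_cancel_right)
qed fact

text \<open>The operator is the row of the \<open>A i\<close> times a column of scalars. Pairing the
  image \<open>y\<close> of \<open>x\<close> with itself and moving each \<open>A i\<close> to the
  other side leaves a scalar sum for Cauchy-Schwarz and the column bound.\<close>

lemma norm_sum_scaleC_le:
  fixes A :: "'i \<Rightarrow> 'h::complex_hilbert \<Rightarrow>\<^sub>L 'h"
  assumes A: "\<And>i. i \<in> I \<Longrightarrow> A i \<in> bounded_operators"
  shows "norm (\<Sum>i\<in>I. c i *\<^sub>C A i)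
    \<le> L2_set (\<lambda>i. cmod (c i)) I * sqrt (norm (\<Sum>i\<in>I. A i o\<^sub>L cadjoint (A i)))"
    (is "_ \<le> ?c * ?a")
proof (rule norm_blinfun_bound)
  fix x
  define y where "y = (\<Sum>i\<in>I. c i *\<^sub>C A i) x"
  have L2: "L2_set (\<lambda>i. norm (cadjoint (A i) y)) I \<le> ?a * norm y"
    unfolding L2_set_def
    using real_sqrt_le_mono[OF sum_power2_norm_cadjoint_le[OF A, where y = y]] by (simp add: real_sqrt_mult)
  have "cinner y z = (\<Sum>i\<in>I. c i * cinner x (cadjoint (A i) z))" for z
    unfolding y_def blinfun.sum_left cinner_sum_left using A
    by (simp add: cinner_cadjoint scaleC_blinfun.rep_eq cinner_scaleC_left)
  then have "(norm y)\<^sup>2 = cmod (\<Sum>i\<in>I. c i * cinner x (cadjoint (A i) y))"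
    by (metis cinner_self norm_of_real abs_power2)
  also have "\<dots> \<le> (\<Sum>i\<in>I. cmod (c i) * (norm x * norm (cadjoint (A i) y)))"
    by (intro sum_norm_le) (simp add: norm_mult Cauchy_Schwarz mult_left_mono)
  also have "\<dots> = norm x * (\<Sum>i\<in>I. cmod (c i) * norm (cadjoint (A i) y))"
    by (simp add: sum_distrib_left mult_ac)
  also have "\<dots> \<le> norm x * (?c * L2_set (\<lambda>i. norm (cadjoint (A i) y)) I)"
    using L2_set_mult_ineq[of "\<lambda>i. cmod (c i)" "\<lambda>i. norm (cadjoint (A i) y)" I]
    by (intro mult_left_mono) auto
  also have "\<dots> \<le> norm x * (?c * (?a * norm y))"
    by (intro mult_left_mono L2 L2_set_nonneg) auto
  finally have "norm y * norm y \<le> (?c * ?a * norm x) * norm y"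
    by (simp add: power2_eq_square mult_ac)
  moreover have "0 \<le> ?c * ?a * norm x"
    by (simp add: L2_set_nonneg)
  ultimately show "norm y \<le> ?c * ?a * norm x"
    by (cases "norm y = 0") (auto simp: mult_le_cancel_right)
qed (simp add: L2_set_nonneg)

section \<open>Words in an operator tuple\<close>

lemma op_word_Nil [simp]: "op_word T [] = id_blinfun"
  by (simp add: op_word_def)

lemma op_word_Cons [simp]: "op_word T (i # \<alpha>) = T i o\<^sub>L op_word T \<alpha>"
  by (simp add: op_word_def)

lemma id_blinfun_compose [simp]: "id_blinfun o\<^sub>L A = A" "A o\<^sub>L id_blinfun = A"
  by (rule blinfun_eqI, simp)+

lemma op_word_append: "op_word T (\<alpha> @ \<beta>) = op_word T \<alpha> o\<^sub>L op_word T \<beta>"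
  by (induction \<alpha>) (simp_all add: blinfun_eqI)

lemma op_word_bounded_operators:
  "(\<And>i. T i \<in> bounded_operators) \<Longrightarrow> op_word T \<alpha> \<in> bounded_operators"
  by (induction \<alpha>) (simp_all add: blinfun_compose_bounded_operators)

lemma finite_words [simp]: "finite {\<alpha> :: 'n::finite list. length \<alpha> = k}"
  using finite_lists_length_eq[of "UNIV :: 'n set" k] by simp

text \<open>The quantity whose root of order \<open>2 * k\<close> appears in the joint spectral
  radius; its square root is the norm of the row of all words of length \<open>k\<close>.\<close>

definition word_gram :: "('n::finite \<Rightarrow> 'h::complex_hilbert \<Rightarrow>\<^sub>L 'h) \<Rightarrow> nat \<Rightarrow> real" where
  "word_gram T k = norm (\<Sum>\<alpha> | length \<alpha> = k. op_word T \<alpha> o\<^sub>L cadjoint (op_word T \<alpha>))"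

lemma word_gram_nonneg [simp]: "0 \<le> word_gram T k"
  by (simp add: word_gram_def)

lemma sum_words_add:
  fixes f :: "'n::finite list \<Rightarrow> 'b::comm_monoid_add"
  shows "(\<Sum>\<gamma> | length \<gamma> = j + k. f \<gamma>)
    = (\<Sum>\<alpha> | length \<alpha> = j. \<Sum>\<beta> | length \<beta> = k. f (\<alpha> @ \<beta>))"
proof -
  have "(\<Sum>\<alpha> | length \<alpha> = j. \<Sum>\<beta> | length \<beta> = k. f (\<alpha> @ \<beta>))
      = (\<Sum>(\<alpha>, \<beta>) \<in> {\<alpha>. length \<alpha> = j} \<times> {\<beta>. length \<beta> = k}. f (\<alpha> @ \<beta>))"
    by (simp add: sum.cartesian_product)
  also have "\<dots> = (\<Sum>\<gamma> | length \<gamma> = j + k. f \<gamma>)"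
    by (rule sum.reindex_bij_witness[where j = "\<lambda>(\<alpha>, \<beta>). \<alpha> @ \<beta>" and i = "\<lambda>\<gamma>. (take j \<gamma>, drop j \<gamma>)"])
      auto
  finally show ?thesis ..
qed

text \<open>The adjoint of a product applies the factors in reverse order: the column bound is used
  on the words \<open>\<beta>\<close> at the vectors \<open>cadjoint (op_word T \<alpha>) y\<close>,
  then on the words \<open>\<alpha>\<close> at \<open>y\<close>.\<close>

lemma word_gram_add_le:
  fixes T :: "'n::finite \<Rightarrow> 'h::complex_hilbert \<Rightarrow>\<^sub>L 'h"
  assumes T: "\<And>i. T i \<in> bounded_operators"
  shows "word_gram T (j + k) \<le> word_gram T j * word_gram T k"
  unfolding word_gram_def[of T "j + k"]
proof (rule norm_sum_compose_cadjoint_le)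
  fix y
  have "(\<Sum>\<gamma> | length \<gamma> = j + k. (norm (cadjoint (op_word T \<gamma>) y))\<^sup>2)
      = (\<Sum>\<alpha> | length \<alpha> = j. \<Sum>\<beta> | length \<beta> = k.
          (norm (cadjoint (op_word T \<beta>) (cadjoint (op_word T \<alpha>) y)))\<^sup>2)"
    unfolding sum_words_add op_word_append
    by (simp add: cadjoint_blinfun_compose op_word_bounded_operators T)
  also have "\<dots> \<le> (\<Sum>\<alpha> | length \<alpha> = j. word_gram T k * (norm (cadjoint (op_word T \<alpha>) y))\<^sup>2)"
    unfolding word_gram_def
    by (intro sum_mono sum_power2_norm_cadjoint_le op_word_bounded_operators T)
  also have "\<dots> \<le> word_gram T k * (word_gram T j * (norm y)\<^sup>2)"
    unfolding sum_distrib_left[symmetric] word_gram_def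
    by (intro mult_left_mono sum_power2_norm_cadjoint_le op_word_bounded_operators T norm_ge_zero)
  finally show "(\<Sum>\<gamma> | length \<gamma> = j + k. (norm (cadjoint (op_word T \<gamma>) y))\<^sup>2)
      \<le> word_gram T j * word_gram T k * (norm y)\<^sup>2"
    by (simp add: mult_ac)
qed (simp_all add: op_word_bounded_operators T)

text \<open>Only an inequality, because the identity has norm 0 on the zero space.\<close>

lemma word_gram_0_le: "word_gram T 0 \<le> 1"
  by (simp add: word_gram_def norm_blinfun_id_le)

lemma word_gram_1: "word_gram T (Suc 0) = norm (\<Sum>i\<in>UNIV. T i o\<^sub>L cadjoint (T i))"
proof -
  have "(\<Sum>\<alpha> | length \<alpha> = Suc 0. op_word T \<alpha> o\<^sub>L cadjoint (op_word T \<alpha>)) = (\<Sum>i\<in>UNIV. T i o\<^sub>L cadjoint (T i))"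
    by (rule sum.reindex_bij_witness[where i = "\<lambda>i. [i]" and j = hd])
      (auto simp: length_Suc_conv)
  then show ?thesis
    by (simp add: word_gram_def)
qed

section \<open>Fekete's lemma and the joint spectral radius\<close>

text \<open>As in Fekete's lemma, the limit is the infimum over \<open>k \<ge> 1\<close>.\<close>
lemma submultiplicative_root_convergent:
  fixes a :: "nat \<Rightarrow> real"
  assumes nonneg: "\<And>k. 0 \<le> a k" and submult: "\<And>j k. a (j + k) \<le> a j * a k"
  shows "convergent (\<lambda>k. root k (a k))"
proof -
  \<comment> \<open>The infimum starts at 1 because \<open>root 0\<close> is constantly 0.\<close>
  define L where "L = (INF k\<in>{1..}. root k (a k))"
  have bdd: "bdd_below ((\<lambda>k. root k (a k)) ` {1..})"
    using nonneg by (intro bdd_belowI[of _ 0]) auto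
  have L_le: "L \<le> root k (a k)" if "k \<ge> 1" for k
    unfolding L_def by (rule cINF_lower[OF bdd]) (use that in simp)
  have "eventually (\<lambda>k. root k (a k) < u') sequentially" if "L < u'" for u'
  proof -
    \<comment> \<open>The gap between \<open>u\<close> and \<open>u'\<close> absorbs the factor
      \<open>root k M\<close>, which tends to 1.\<close>
    obtain u where u: "L < u" "u < u'"
      using dense[OF \<open>L < u'\<close>] by blast
    then have "\<exists>p\<in>{1..}. root p (a p) < u"
      unfolding L_def by (subst (asm) cINF_less_iff[OF _ bdd]) auto
    then obtain p where p: "p \<ge> 1" "root p (a p) < u"
      by auto
    have "0 < u"
      using real_root_ge_zero[OF nonneg[of p], of p] p(2) by linarith
    have "root p (a p) ^ p \<le> u ^ p"
      using p(2) by (intro power_mono real_root_ge_zero nonneg) simp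
    then have a_p: "a p \<le> u ^ p"
      using p(1) nonneg[of p] by (simp add: real_root_pow_pos2)
    \<comment> \<open>Splits off \<open>m\<close> blocks of length \<open>p\<close>; below,
      \<open>i\<close> is the remainder of \<open>k\<close> modulo \<open>p\<close>.\<close>
    have a_mult: "a (m * p + i) \<le> (u ^ p) ^ m * a i" for m i
    proof (induction m)
      case (Suc m)
      have "a (Suc m * p + i) \<le> a p * a (m * p + i)"
        using submult[of p "m * p + i"] by (simp add: add.assoc)
      also have "\<dots> \<le> u ^ p * ((u ^ p) ^ m * a i)"
        using Suc a_p nonneg \<open>0 < u\<close> by (intro mult_mono) auto
      finally show ?case
        by (simp add: mult.assoc)
    qed simp
    \<comment> \<open>One constant for all remainders; the summand 1 makes it positive, as the limit
      of \<open>root k M\<close> requires.\<close>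
    define M where "M = 1 + (\<Sum>i<p. a i / u ^ i)"
    have "M > 0"
      unfolding M_def using nonneg \<open>0 < u\<close> by (intro add_pos_nonneg sum_nonneg) auto
    have a_le: "a k \<le> M * u ^ k" for k
    proof -
      have "a (k mod p) / u ^ (k mod p) \<le> (\<Sum>i<p. a i / u ^ i)"
        using nonneg \<open>0 < u\<close> p(1) by (intro member_le_sum) auto
      then have "a (k mod p) / u ^ (k mod p) \<le> M"
        by (simp add: M_def)
      then have "a (k mod p) \<le> M * u ^ (k mod p)"
        using \<open>0 < u\<close> by (simp add: pos_divide_le_eq)
      then have "(u ^ p) ^ (k div p) * a (k mod p) \<le> (u ^ p) ^ (k div p) * (M * u ^ (k mod p))"
        using \<open>0 < u\<close> by (intro mult_left_mono) auto
      also have "\<dots> = M * u ^ (p * (k div p) + k mod p)"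
        unfolding power_add power_mult by (rule mult.left_commute)
      finally show ?thesis
        using a_mult[of "k div p" "k mod p"] by simp
    qed
    have root_le: "root k (a k) \<le> root k M * u" if "k \<ge> 1" for k
    proof -
      have "root k (a k) \<le> root k (M * u ^ k)"
        using that by (intro real_root_le_mono a_le) simp
      also have "\<dots> = root k M * u"
        using that \<open>0 < u\<close> by (simp add: real_root_mult real_root_power_cancel)
      finally show ?thesis .
    qed
    have "(\<lambda>k. root k M * u) \<longlonglongrightarrow> 1 * u"
      using \<open>M > 0\<close> by (intro tendsto_intros LIMSEQ_root_const)
    then have "eventually (\<lambda>k. root k M * u < u') sequentially"
      using u(2) by (intro order_tendstoD(2)) auto
    then show ?thesis
      using eventually_ge_at_top[of 1] by eventually_elim (rule le_less_trans[OF root_le])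
  qed
  moreover have "eventually (\<lambda>k. u < root k (a k)) sequentially" if "u < L" for u
    using eventually_ge_at_top[of 1] by eventually_elim (rule less_le_trans[OF that L_le])
  ultimately have "(\<lambda>k. root k (a k)) \<longlonglongrightarrow> L"
    by (intro order_tendstoI) auto
  then show ?thesis
    by (rule convergentI)
qed

text \<open>The radius is defined through \<open>lim\<close>, so the assumption says something only
  once convergence is known; Fekete provides it. Any \<open>q\<close> strictly between the limit and
  1 then bounds the tail, and \<open>C\<close> takes care of the finitely many remaining
  \<open>k\<close>.\<close>

lemma joint_spectral_radius_less_1_imp_bound:
  fixes T :: "'n::finite \<Rightarrow> 'h::complex_hilbert \<Rightarrow>\<^sub>L 'h"
  assumes T: "\<And>i. T i \<in> bounded_operators" and r: "joint_spectral_radius T < 1"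
  obtains C q where "0 < q" "q < 1" "0 < C" "\<And>k. sqrt (word_gram T k) \<le> C * q ^ k"
proof -
  have "convergent (\<lambda>k. root k (word_gram T k))"
    by (intro submultiplicative_root_convergent word_gram_add_le T word_gram_nonneg)
  then obtain L where L: "(\<lambda>k. root k (word_gram T k)) \<longlonglongrightarrow> L"
    unfolding convergent_def by blast
  have lim: "(\<lambda>k. root (2 * k) (word_gram T k)) \<longlonglongrightarrow> sqrt L"
    unfolding real_root_mult_exp using tendsto_real_sqrt[OF L] by (simp add: sqrt_def)
  then have "sqrt L < 1"
    using r limI[OF lim] by (simp add: joint_spectral_radius_def word_gram_def)
  \<comment> \<open>The maximum with 0 forces \<open>q\<close> to be positive, so that dividing by
    its powers is possible.\<close>
  then obtain q where q: "max 0 (sqrt L) < q" "q < 1"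
    using dense[of "max 0 (sqrt L)" 1] by auto
  have "eventually (\<lambda>k. root (2 * k) (word_gram T k) < q) sequentially"
    using q(1) by (intro order_tendstoD(2)[OF lim]) simp
  then obtain N where N: "\<And>k. k \<ge> N \<Longrightarrow> root (2 * k) (word_gram T k) < q"
    by (auto simp: eventually_sequentially)
  \<comment> \<open>Starting at \<open>Suc N\<close> excludes \<open>k = 0\<close>, where taking the
    root loses all information.\<close>
  have large: "sqrt (word_gram T k) \<le> q ^ k" if "k \<ge> Suc N" for k
  proof -
    have "root k (sqrt (word_gram T k)) \<le> q"
      using N[of k] that real_root_mult_exp[of k 2] by (simp add: sqrt_def mult.commute)
    then have "root k (sqrt (word_gram T k)) ^ k \<le> q ^ k"
      by (intro power_mono real_root_ge_zero) simp_all
    then show ?thesis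
      using that by (simp add: real_root_pow_pos2)
  qed
  \<comment> \<open>The summand 1 covers \<open>k > N\<close>, the sum covers
    \<open>k \<le> N\<close>.\<close>
  define C where "C = 1 + (\<Sum>k\<le>N. sqrt (word_gram T k) / q ^ k)"
  show thesis
  proof
    show "0 < q" "q < 1"
      using q by simp_all
    show "0 < C"
      unfolding C_def using \<open>0 < q\<close> by (intro add_pos_nonneg sum_nonneg) auto
    show "sqrt (word_gram T k) \<le> C * q ^ k" for k
    proof (cases "k \<le> N")
      case True
      then have "sqrt (word_gram T k) / q ^ k \<le> (\<Sum>k\<le>N. sqrt (word_gram T k) / q ^ k)"
        using \<open>0 < q\<close> by (intro member_le_sum) auto
      then have "sqrt (word_gram T k) / q ^ k \<le> C"
        by (simp add: C_def)
      then show ?thesis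
        using \<open>0 < q\<close> by (simp add: pos_divide_le_eq)
    next
      case False
      have "1 \<le> C"
        unfolding C_def using \<open>0 < q\<close> by (simp add: sum_nonneg)
      then have "q ^ k \<le> C * q ^ k"
        using \<open>0 < q\<close> by simp
      then show ?thesis
        using large[of k] False by simp
    qed
  qed
qed

text \<open>Iterated submultiplicativity, starting from words of length one, whose Gram norm is the
  one in \<open>row_ball\<close>.\<close>

lemma row_ball_imp_word_gram_le:
  assumes "X \<in> row_ball s" and "0 \<le> s"
  shows "sqrt (word_gram X k) \<le> s ^ k"
proof (induction k)
  case 0
  show ?case
    using word_gram_0_le[of X] by simp
next
  case (Suc k)
  have "sqrt (word_gram X (1 + k)) \<le> sqrt (word_gram X 1) * sqrt (word_gram X k)"
    using assms(1) unfolding row_ball_def real_sqrt_mult[symmetric]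
    by (intro real_sqrt_le_mono word_gram_add_le) simp
  also have "\<dots> \<le> s * s ^ k"
    using assms Suc unfolding row_ball_def by (intro mult_mono) (simp_all add: word_gram_1)
  finally show ?case
    by simp
qed

section \<open>Evaluation of free holomorphic functions\<close>

definition degree_norm :: "('n::finite) nc_series \<Rightarrow> nat \<Rightarrow> real" where
  "degree_norm f k = L2_set (\<lambda>\<alpha>. cmod (f \<alpha>)) {\<alpha>. length \<alpha> = k}"

definition nc_diff :: "'n nc_series \<Rightarrow> 'n nc_series \<Rightarrow> 'n nc_series" where
  "nc_diff f g = (\<lambda>\<alpha>. f \<alpha> - g \<alpha>)"

lemma degree_norm_nonneg [simp]: "0 \<le> degree_norm f k"
  by (simp add: degree_norm_def L2_set_nonneg)

lemma degree_norm_diff_le: "degree_norm (nc_diff f g) k \<le> degree_norm f k + degree_norm g k"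
proof -
  have "degree_norm (nc_diff f g) k \<le> L2_set (\<lambda>\<alpha>. cmod (f \<alpha>) + cmod (g \<alpha>)) {\<alpha>. length \<alpha> = k}"
    unfolding degree_norm_def nc_diff_def by (intro L2_set_mono norm_triangle_ineq4) simp
  also have "\<dots> \<le> degree_norm f k + degree_norm g k"
    unfolding degree_norm_def by (rule L2_set_triangle_ineq)
  finally show ?thesis .
qed

text \<open>Root test: the root of order \<open>2 * k\<close> of the sum of squares is the root of
  order \<open>k\<close> of \<open>degree_norm f k\<close>.\<close>

lemma Hol_imp_eventually_degree_norm_le:
  assumes "f \<in> Hol" and "1 < p"
  shows "eventually (\<lambda>k. degree_norm f k \<le> p ^ k) sequentially"
proof -
  have "limsup (\<lambda>k. ereal (root (2 * k) (\<Sum>\<alpha> | length \<alpha> = k. (cmod (f \<alpha>))\<^sup>2))) < ereal p"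
    using assms le_less_trans[of _ 1 "ereal p"] unfolding Hol_def by simp
  then have "eventually (\<lambda>k. root (2 * k) (\<Sum>\<alpha> | length \<alpha> = k. (cmod (f \<alpha>))\<^sup>2) < p) sequentially"
    using Limsup_lessD by fastforce
  then show ?thesis
    using eventually_gt_at_top[of 0]
  proof eventually_elim
    case (elim k)
    have "root k (degree_norm f k) \<le> p"
      using elim(1) real_root_mult_exp[of k 2]
      by (simp add: degree_norm_def L2_set_def sqrt_def mult.commute)
    then have "root k (degree_norm f k) ^ k \<le> p ^ k"
      by (intro power_mono real_root_ge_zero) simp_all
    then show ?case
      using elim(2) by (simp add: real_root_pow_pos2)
  qed
qed

lemma Hol_imp_summable:
  assumes "f \<in> Hol" and "0 \<le> s" and "s < 1"
  shows "summable (\<lambda>k. degree_norm f k * s ^ k)"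
proof (rule summable_comparison_test_ev)
  \<comment> \<open>Chosen so that \<open>1 < p\<close> and \<open>p * s < 1\<close> hold together,
    including at \<open>s = 0\<close>.\<close>
  define p where "p = 2 / (1 + s)"
  have p: "1 < p" "0 \<le> p * s" "p * s < 1"
    using assms(2,3) by (auto simp: p_def field_simps)
  show "summable (\<lambda>k. (p * s) ^ k)"
    using p by (intro summable_geometric) simp
  show "eventually (\<lambda>k. norm (degree_norm f k * s ^ k) \<le> (p * s) ^ k) sequentially"
    using Hol_imp_eventually_degree_norm_le[OF assms(1) p(1)]
    by eventually_elim (use \<open>0 \<le> s\<close> in \<open>simp add: power_mult_distrib mult_right_mono\<close>)
qed

lemma summable_degree_norm_diff:
  assumes "summable (\<lambda>k. degree_norm f k * s ^ k)" and "summable (\<lambda>k. degree_norm g k * s ^ k)"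
    and "0 \<le> s"
  shows "summable (\<lambda>k. degree_norm (nc_diff f g) k * s ^ k)"
proof (rule summable_comparison_test')
  show "summable (\<lambda>k. degree_norm f k * s ^ k + degree_norm g k * s ^ k)"
    using assms(1,2) by (rule summable_add)
  show "norm (degree_norm (nc_diff f g) k * s ^ k) \<le> degree_norm f k * s ^ k + degree_norm g k * s ^ k" for k
    using degree_norm_diff_le[of f g k] \<open>0 \<le> s\<close>
    by (simp add: mult_right_mono flip: distrib_right)
qed

lemma finite_degree_imp_Hol:
  assumes "\<And>\<alpha>. N < length \<alpha> \<Longrightarrow> f \<alpha> = 0"
  shows "f \<in> Hol"
proof -
  have "eventually (\<lambda>k. ereal (root (2 * k) (\<Sum>\<alpha> | length \<alpha> = k. (cmod (f \<alpha>))\<^sup>2)) \<le> 1) sequentially"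
    using eventually_gt_at_top[of N]
  proof eventually_elim
    case (elim k)
    then have "(\<Sum>\<alpha> | length \<alpha> = k. (cmod (f \<alpha>))\<^sup>2) = 0"
      using assms by (intro sum.neutral) auto
    then show ?case
      by simp
  qed
  then show ?thesis
    unfolding Hol_def mem_Collect_eq by (rule Limsup_bounded)
qed

section \<open>Homogeneous parts and their products\<close>

definition homogeneous_eval ::
    "('n::finite) nc_series \<Rightarrow> ('n \<Rightarrow> 'h::complex_hilbert \<Rightarrow>\<^sub>L 'h) \<Rightarrow> nat \<Rightarrow> ('h \<Rightarrow>\<^sub>L 'h)" where
  "homogeneous_eval f T k = (\<Sum>\<alpha> | length \<alpha> = k. f \<alpha> *\<^sub>C op_word T \<alpha>)"

lemma nc_eval_eq: "nc_eval f T = (\<Sum>k. homogeneous_eval f T k)"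
  by (simp add: nc_eval_def homogeneous_eval_def)

lemma norm_homogeneous_eval_le:
  assumes "\<And>i. T i \<in> bounded_operators"
  shows "norm (homogeneous_eval f T k) \<le> degree_norm f k * sqrt (word_gram T k)"
  unfolding homogeneous_eval_def degree_norm_def word_gram_def
  by (intro norm_sum_scaleC_le op_word_bounded_operators assms)

lemma homogeneous_eval_diff:
  "homogeneous_eval (nc_diff f g) T k = homogeneous_eval f T k - homogeneous_eval g T k"
  by (rule blinfun_eqI)
    (simp add: homogeneous_eval_def nc_diff_def blinfun.diff_left blinfun.sum_left
      scaleC_blinfun.rep_eq complex_hilbert.scale_left_diff_distrib sum_subtractf)

lemma homogeneous_eval_add:
  "homogeneous_eval (nc_add f g) T k = homogeneous_eval f T k + homogeneous_eval g T k"
  by (rule blinfun_eqI)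
    (simp add: homogeneous_eval_def nc_add_def blinfun.add_left blinfun.sum_left
      scaleC_blinfun.rep_eq scaleC_add_left sum.distrib)

lemma homogeneous_eval_scale:
  "homogeneous_eval (nc_scale c f) T k = c *\<^sub>C homogeneous_eval f T k"
  by (rule blinfun_eqI)
    (simp add: homogeneous_eval_def nc_scale_def blinfun.sum_left
      scaleC_blinfun.rep_eq complex_hilbert.scale_sum_right scaleC_scaleC)

lemma homogeneous_eval_bounded_operators:
  "(\<And>i. T i \<in> bounded_operators) \<Longrightarrow> homogeneous_eval f T k \<in> bounded_operators"
  unfolding homogeneous_eval_def
  by (intro bounded_operators_sum bounded_operators_scaleC op_word_bounded_operators)

text \<open>A factorisation of a word is determined by its cut position.\<close>

lemma sum_decompositions:
  fixes F :: "'n list \<Rightarrow> 'n list \<Rightarrow> 'b::comm_monoid_add"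
  shows "(\<Sum>(\<beta>, \<gamma>) | \<beta> @ \<gamma> = \<alpha>. F \<beta> \<gamma>) = (\<Sum>j\<le>length \<alpha>. F (take j \<alpha>) (drop j \<alpha>))"
  by (rule sum.reindex_bij_witness[where j = "\<lambda>(\<beta>, \<gamma>). length \<beta>" and i = "\<lambda>j. (take j \<alpha>, drop j \<alpha>)"])
    auto

text \<open>Summing over words of length \<open>k\<close> and cut positions \<open>j\<close> is the
  same as summing over \<open>j\<close> and over pairs of words of lengths \<open>j\<close> and
  \<open>k - j\<close>; the coefficients and the operator words factor accordingly.\<close>

lemma homogeneous_eval_mult:
  fixes T :: "'n::finite \<Rightarrow> 'h::complex_hilbert \<Rightarrow>\<^sub>L 'h"
  assumes T: "\<And>i. T i \<in> bounded_operators"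
  shows "homogeneous_eval (nc_mult f g) T k
    = (\<Sum>j\<le>k. homogeneous_eval f T j o\<^sub>L homogeneous_eval g T (k - j))"
proof (rule blinfun_eqI)
  fix x
  \<comment> \<open>Complex linearity of the words lets the coefficients of \<open>g\<close> move
    past the left factor.\<close>
  have op: "op_word T \<alpha> (c *\<^sub>C y) = c *\<^sub>C op_word T \<alpha> y" for \<alpha> c y
    using op_word_bounded_operators[of T \<alpha>] T by (simp add: bounded_operators_def)
  have "homogeneous_eval (nc_mult f g) T k x
      = (\<Sum>\<alpha> | length \<alpha> = k. \<Sum>j\<le>k. (f (take j \<alpha>) * g (drop j \<alpha>)) *\<^sub>C op_word T \<alpha> x)"
    unfolding homogeneous_eval_def nc_mult_def sum_decompositions
    by (auto simp: blinfun.sum_left scaleC_blinfun.rep_eq complex_hilbert.scale_sum_left)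
  also have "\<dots> = (\<Sum>j\<le>k. \<Sum>\<alpha> | length \<alpha> = k. (f (take j \<alpha>) * g (drop j \<alpha>)) *\<^sub>C op_word T \<alpha> x)"
    by (rule sum.swap)
  also have "\<dots> = (\<Sum>j\<le>k. (homogeneous_eval f T j o\<^sub>L homogeneous_eval g T (k - j)) x)"
  proof (rule sum.cong[OF refl])
    fix j
    assume "j \<in> {..k}"
    then have "(\<Sum>\<alpha> | length \<alpha> = k. (f (take j \<alpha>) * g (drop j \<alpha>)) *\<^sub>C op_word T \<alpha> x)
        = (\<Sum>\<beta> | length \<beta> = j. \<Sum>\<gamma> | length \<gamma> = k - j. (f \<beta> * g \<gamma>) *\<^sub>C op_word T (\<beta> @ \<gamma>) x)"
      using sum_words_add[where j = j and k = "k - j" and f = "\<lambda>\<alpha>. (f (take j \<alpha>) * g (drop j \<alpha>)) *\<^sub>C op_word T \<alpha> x"] by simp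
    also have "\<dots> = (homogeneous_eval f T j o\<^sub>L homogeneous_eval g T (k - j)) x"
      by (simp add: homogeneous_eval_def op_word_append op blinfun.sum_left blinfun.sum_right
          scaleC_blinfun.rep_eq complex_hilbert.scale_sum_right scaleC_scaleC) (rule sum.swap)
    finally show "(\<Sum>\<alpha> | length \<alpha> = k. (f (take j \<alpha>) * g (drop j \<alpha>)) *\<^sub>C op_word T \<alpha> x)
        = (homogeneous_eval f T j o\<^sub>L homogeneous_eval g T (k - j)) x" .
  qed
  finally show "homogeneous_eval (nc_mult f g) T k x
      = (\<Sum>j\<le>k. homogeneous_eval f T j o\<^sub>L homogeneous_eval g T (k - j)) x"
    by (simp add: blinfun.sum_left)
qed

interpretation blinfun_compose: bounded_bilinear "(o\<^sub>L)"
  by (rule bounded_bilinear_blinfun_compose)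

text \<open>Mertens' argument for operators. The partial sums differ from
  \<open>(\<Sum>j\<le>n. a j) o\<^sub>L B\<close> by the sum of
  \<open>a j o\<^sub>L (S (n - j) - B)\<close>. Each such term tends to 0 and is dominated by a
  multiple of \<open>norm (a j)\<close>, so dominated convergence for series applies.\<close>

lemma blinfun_compose_Cauchy_product_sums:
  fixes a b :: "nat \<Rightarrow> 'h::banach \<Rightarrow>\<^sub>L 'h"
  assumes a: "summable (\<lambda>k. norm (a k))" and b: "summable (\<lambda>k. norm (b k))"
  shows "(\<lambda>k. \<Sum>j\<le>k. a j o\<^sub>L b (k - j)) sums ((\<Sum>k. a k) o\<^sub>L (\<Sum>k. b k))"
proof -
  define S where "S n = (\<Sum>j\<le>n. b j)" for n
  define B where "B = (\<Sum>k. b k)"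
  have S: "S \<longlonglongrightarrow> B"
    unfolding S_def B_def by (rule summable_LIMSEQ'[OF summable_norm_cancel[OF b]])
  have partial: "(\<Sum>k\<le>n. \<Sum>j\<le>k. a j o\<^sub>L b (k - j)) = (\<Sum>j\<le>n. a j o\<^sub>L S (n - j))" for n
  proof (induction n)
    case (Suc n)
    have "(\<Sum>j\<le>n. a j o\<^sub>L S (Suc n - j)) = (\<Sum>j\<le>n. a j o\<^sub>L S (n - j)) + (\<Sum>j\<le>n. a j o\<^sub>L b (Suc n - j))"
      unfolding sum.distrib[symmetric]
      by (intro sum.cong refl) (simp add: S_def Suc_diff_le blinfun_compose.add_right)
    with Suc show ?case
      by (simp add: S_def)
  qed (simp add: S_def)
  obtain D where D: "\<And>n. norm (S n - B) \<le> D"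
    using S[THEN LIM_zero, THEN convergentI, THEN convergent_imp_Bseq] unfolding Bseq_def by blast
  \<comment> \<open>Extension by 0 for \<open>j > n\<close> turns the finite error sums into series
    over a fixed index set, as Tannery's theorem expects.\<close>
  define t where "t j n = (if j \<le> n then norm (a j) * norm (S (n - j) - B) else 0)" for j n
  have "t j \<longlonglongrightarrow> 0" for j
  proof -
    have "(\<lambda>n. norm (a j) * norm (S n - B)) \<longlonglongrightarrow> norm (a j) * 0"
      using tendsto_norm_zero[OF LIM_zero[OF S]] by (rule tendsto_mult_left)
    moreover have "t j (n + j) = norm (a j) * norm (S n - B)" for n
      by (simp add: t_def)
    ultimately show ?thesis
      using LIMSEQ_offset[of "t j" j 0] by simp
  qed
  moreover have "eventually (\<lambda>(j, n). norm (t j n) \<le> norm (a j) * D) (at_top \<times>\<^sub>F sequentially)"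
    using D order_trans[OF norm_ge_zero D] by (intro always_eventually) (auto simp: t_def mult_left_mono)
  moreover have "summable (\<lambda>j. norm (a j) * D)"
    using a by (rule summable_mult2)
  ultimately have t: "(\<lambda>n. \<Sum>j. t j n) \<longlonglongrightarrow> 0"
    using tannerys_theorem[of t "\<lambda>_. 0" sequentially "\<lambda>j. norm (a j) * D"] by simp
  have t_bound: "norm ((\<Sum>j\<le>n. a j o\<^sub>L S (n - j)) - ((\<Sum>j\<le>n. a j) o\<^sub>L B)) \<le> (\<Sum>j. t j n)" for n
  proof -
    have "(\<Sum>j. t j n) = (\<Sum>j\<le>n. t j n)"
      by (rule suminf_finite) (auto simp: t_def)
    moreover have "norm ((\<Sum>j\<le>n. a j o\<^sub>L S (n - j)) - ((\<Sum>j\<le>n. a j) o\<^sub>L B)) \<le> (\<Sum>j\<le>n. t j n)"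
      unfolding blinfun_compose.sum_left sum_subtractf[symmetric] blinfun_compose.diff_right[symmetric]
      by (intro sum_norm_le) (simp add: t_def norm_blinfun_compose)
    ultimately show ?thesis
      by simp
  qed
  have "(\<lambda>n. (\<Sum>j\<le>n. a j o\<^sub>L S (n - j)) - ((\<Sum>j\<le>n. a j) o\<^sub>L B)) \<longlonglongrightarrow> 0"
    by (rule Lim_null_comparison[OF _ t]) (simp only: t_bound eventually_True)
  moreover have "(\<lambda>n. (\<Sum>j\<le>n. a j) o\<^sub>L B) \<longlonglongrightarrow> ((\<Sum>k. a k) o\<^sub>L B)"
    by (rule blinfun_compose.tendsto[OF summable_LIMSEQ'[OF summable_norm_cancel[OF a]] tendsto_const])
  ultimately have "(\<lambda>n. \<Sum>j\<le>n. a j o\<^sub>L S (n - j)) \<longlonglongrightarrow> ((\<Sum>k. a k) o\<^sub>L B)"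
    by (rule Lim_transform[rotated])
  then show ?thesis
    unfolding sums_def_le partial B_def .
qed

text \<open>Common setting for two cases: the given tuple, with \<open>C\<close> and
  \<open>q\<close> obtained from its spectral radius, and the tuples of a row ball of radius
  \<open>s < 1\<close>, with \<open>C = 1\<close> and \<open>q = s\<close>.\<close>

locale power_bounded_tuple =
  fixes T :: "'n::finite \<Rightarrow> 'h::complex_hilbert \<Rightarrow>\<^sub>L 'h" and C q :: real
  assumes T: "T i \<in> bounded_operators"
    and q_nonneg: "0 \<le> q" and q_less_1: "q < 1" and C_nonneg: "0 \<le> C"
    and word_gram_le: "sqrt (word_gram T k) \<le> C * q ^ k"
begin

lemma norm_homogeneous_eval_bound:
  "norm (homogeneous_eval f T k) \<le> C * (degree_norm f k * q ^ k)"
proof -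
  have "norm (homogeneous_eval f T k) \<le> degree_norm f k * (C * q ^ k)"
    using norm_homogeneous_eval_le[OF T] mult_left_mono[OF word_gram_le degree_norm_nonneg]
    by (rule order_trans)
  then show ?thesis
    by (simp add: mult_ac)
qed

lemma summable_norm_homogeneous_eval:
  assumes "summable (\<lambda>k. degree_norm f k * q ^ k)"
  shows "summable (\<lambda>k. norm (homogeneous_eval f T k))"
  by (rule summable_comparison_test'[OF summable_mult[OF assms, of C]])
    (simp add: norm_homogeneous_eval_bound)

lemmas summable_homogeneous_eval = summable_norm_cancel[OF summable_norm_homogeneous_eval]

lemma norm_nc_eval_le:
  assumes "summable (\<lambda>k. degree_norm f k * q ^ k)"
  shows "norm (nc_eval f T) \<le> C * (\<Sum>k. degree_norm f k * q ^ k)"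
proof -
  have "norm (nc_eval f T) \<le> (\<Sum>k. norm (homogeneous_eval f T k))"
    unfolding nc_eval_eq by (rule summable_norm[OF summable_norm_homogeneous_eval[OF assms]])
  also have "\<dots> \<le> (\<Sum>k. C * (degree_norm f k * q ^ k))"
    by (intro suminf_le norm_homogeneous_eval_bound summable_norm_homogeneous_eval summable_mult assms)
  also have "\<dots> = C * (\<Sum>k. degree_norm f k * q ^ k)"
    by (rule suminf_mult[OF assms])
  finally show ?thesis .
qed

lemma nc_eval_diff:
  assumes "summable (\<lambda>k. degree_norm f k * q ^ k)" and "summable (\<lambda>k. degree_norm g k * q ^ k)"
  shows "nc_eval (nc_diff f g) T = nc_eval f T - nc_eval g T"
  unfolding nc_eval_eq homogeneous_eval_diff
  by (rule suminf_diff[symmetric]) (intro summable_homogeneous_eval assms)+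

lemma nc_eval_bounded_operators:
  assumes "summable (\<lambda>k. degree_norm f k * q ^ k)"
  shows "nc_eval f T \<in> bounded_operators"
  unfolding nc_eval_eq
  by (rule closed_sequentially[OF closed_bounded_operators _ summable_LIMSEQ[OF summable_homogeneous_eval[OF assms]]])
    (intro bounded_operators_sum homogeneous_eval_bounded_operators T)

text \<open>Every law holds degree by degree and passes to the sum by norm convergence;
  multiplicativity uses absolute convergence through the Cauchy product.\<close>

lemma unital_algebra_hom_nc_eval: "unital_algebra_hom (\<lambda>f. nc_eval f T)"
  unfolding unital_algebra_hom_def
proof (intro conjI ballI allI)
  fix f g :: "'n nc_series" and c
  assume "f \<in> Hol"
  then have f: "summable (\<lambda>k. degree_norm f k * q ^ k)"
    using q_nonneg q_less_1 by (rule Hol_imp_summable)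
  show "nc_eval f T \<in> bounded_operators"
    using f by (rule nc_eval_bounded_operators)
  have "bounded_linear (\<lambda>A :: 'h \<Rightarrow>\<^sub>L 'h. c *\<^sub>C A)"
  proof (rule bounded_linear_intro[where K = "cmod c"])
    show "norm (c *\<^sub>C A) \<le> norm A * cmod c" for A :: "'h \<Rightarrow>\<^sub>L 'h"
      by (rule norm_blinfun_bound)
        (use mult_left_mono[OF norm_blinfun[of A], of "cmod c"] in
          \<open>simp_all add: scaleC_blinfun.rep_eq norm_scaleC mult_ac\<close>)
  qed (auto intro!: blinfun_eqI simp: scaleC_blinfun.rep_eq blinfun.add_left blinfun.scaleR_left
      scaleC_add_right scaleR_eq_scaleC scaleC_scaleC mult.commute)
  from bounded_linear.suminf[OF this summable_homogeneous_eval[OF f]]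
  show "nc_eval (nc_scale c f) T = c *\<^sub>C nc_eval f T"
    unfolding nc_eval_eq homogeneous_eval_scale by simp
  assume "g \<in> Hol"
  then have g: "summable (\<lambda>k. degree_norm g k * q ^ k)"
    using q_nonneg q_less_1 by (rule Hol_imp_summable)
  show "nc_eval (nc_add f g) T = nc_eval f T + nc_eval g T"
    unfolding nc_eval_eq homogeneous_eval_add
    by (rule suminf_add[symmetric]) (intro summable_homogeneous_eval f g)+
  show "nc_eval (nc_mult f g) T = nc_eval f T o\<^sub>L nc_eval g T"
    unfolding nc_eval_eq homogeneous_eval_mult[OF T]
    by (rule sums_unique[symmetric], rule blinfun_compose_Cauchy_product_sums)
      (intro summable_norm_homogeneous_eval f g)+
next
  \<comment> \<open>Only the empty word contributes, so the series reduces to its term of degree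
    0.\<close>
  have "homogeneous_eval nc_one T k = (if k = 0 then id_blinfun else 0)" for k
  proof -
    have "homogeneous_eval nc_one T k = (\<Sum>\<alpha> :: 'n list | length \<alpha> = k. if \<alpha> = [] then id_blinfun else 0)"
      unfolding homogeneous_eval_def nc_one_def
      by (rule sum.cong[OF refl], rule blinfun_eqI) (simp add: scaleC_blinfun.rep_eq scaleC_one)
    then show ?thesis
      by simp
  qed
  then show "nc_eval nc_one T = id_blinfun"
    unfolding nc_eval_eq by (subst suminf_finite[of "{0}"]) simp_all
qed

end

lemma row_ball_power_bounded_tuple:
  assumes "X \<in> row_ball s" and "0 \<le> s" and "s < 1"
  shows "power_bounded_tuple X 1 s"
  using assms row_ball_imp_word_gram_le[OF assms(1,2)]
  by unfold_locales (auto simp: row_ball_def)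

section \<open>Truncated creation operators and Cauchy estimates\<close>

text \<open>Gram-Schmidt, one vector at a time: a finite family never spans, so there is a vector
  outside its span, and its normalised component orthogonal to the family extends it.\<close>

lemma infinite_dimensional_imp_orthonormal:
  fixes E :: "'e::complex_hilbert itself"
  assumes inf: "infinite_dimensional E" and "finite A"
  shows "\<exists>e :: 'i \<Rightarrow> 'e. orthonormal_on A e"
  using \<open>finite A\<close>
proof (induction A rule: finite_induct)
  case empty
  show ?case
    by (simp add: orthonormal_on_def)
next
  case (insert a A)
  then obtain e :: "'i \<Rightarrow> 'e" where e: "orthonormal_on A e"
    by blast
  have "complex_hilbert.span (e ` A) \<noteq> UNIV"
    using inf insert(1) unfolding infinite_dimensional_def by blast
  then obtain x where x: "x \<notin> complex_hilbert.span (e ` A)"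
    by blast
  define p where "p = (\<Sum>b\<in>A. cinner x (e b) *\<^sub>C e b)"
  have "p \<in> complex_hilbert.span (e ` A)"
    unfolding p_def
    by (intro complex_hilbert.span_sum complex_hilbert.span_scale complex_hilbert.span_base) simp
  with x have "x \<noteq> p"
    by blast
  have orth: "cinner (x - p) (e b) = 0" if "b \<in> A" for b
    using cinner_orthonormal_sum[OF insert(1) e that, of "\<lambda>a. cinner x (e a)"]
    by (simp add: p_def cinner_diff_left)
  define u where "u = (1 / norm (x - p)) *\<^sub>R (x - p)"
  have u_orth: "cinner u (e b) = 0" "cinner (e b) u = 0" if "b \<in> A" for b
    using orth[OF that] cinner_commute[of "e b" "x - p"]
    by (simp_all add: u_def cinner_scaleR_left cinner_scaleR_right)
  have "cinner u u = 1"
    using \<open>x \<noteq> p\<close> by (simp add: u_def cinner_self)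
  then have "orthonormal_on (insert a A) (e(a := u))"
    using e u_orth insert(2) unfolding orthonormal_on_def by auto
  then show ?case
    by blast
qed

text \<open>A sum of rank one operators: \<open>u\<close> supplies the functionals and
  \<open>v\<close> the ranges. Passing to the adjoint exchanges the two.\<close>

definition finite_rank :: "'i set \<Rightarrow> ('i \<Rightarrow> 'e) \<Rightarrow> ('i \<Rightarrow> 'e) \<Rightarrow> ('e::complex_hilbert \<Rightarrow>\<^sub>L 'e)" where
  "finite_rank A u v = Blinfun (\<lambda>x. \<Sum>a\<in>A. cinner x (u a) *\<^sub>C v a)"

lemma finite_rank_apply: "finite_rank A u v x = (\<Sum>a\<in>A. cinner x (u a) *\<^sub>C v a)"
proof -
  have "bounded_linear (\<lambda>x. cinner x (u a) *\<^sub>C v a)" for a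
  proof (rule bounded_linear_intro[where K = "norm (u a) * norm (v a)"])
    show "norm (cinner x (u a) *\<^sub>C v a) \<le> norm x * (norm (u a) * norm (v a))" for x
      using mult_right_mono[OF Cauchy_Schwarz[of x "u a"], of "norm (v a)"]
      by (simp add: norm_scaleC mult.assoc)
  qed (simp_all add: cinner_add_left scaleC_add_left cinner_scaleR_left scaleR_eq_scaleC scaleC_scaleC
      cinner_scaleC_left)
  then show ?thesis
    unfolding finite_rank_def by (subst bounded_linear_Blinfun_apply) (auto intro: bounded_linear_sum)
qed

lemma finite_rank_bounded_operators: "finite_rank A u v \<in> bounded_operators"
  by (simp add: bounded_operators_def finite_rank_apply cinner_scaleC_left
      complex_hilbert.scale_sum_right scaleC_scaleC)

lemma cadjoint_finite_rank: "cadjoint (finite_rank A u v) = finite_rank A v u"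
proof (rule cadjoint_unique)
  fix x y
  show "cinner (finite_rank A u v x) y = cinner x (finite_rank A v u y)"
    unfolding finite_rank_apply cinner_sum_left cinner_sum_right
    by (intro sum.cong refl) (simp add: cinner_scaleC_left cinner_scaleC_right mult.commute flip: cinner_commute)
qed

text \<open>The vectors \<open>e \<alpha>\<close> model the full Fock space cut off above degree
  \<open>N\<close>. The operators below prepend a letter and multiply by \<open>s\<close>; they
  annihilate the top degree.\<close>

locale truncated_creation =
  fixes N :: nat and e :: "'n::finite list \<Rightarrow> 'e::complex_hilbert" and s :: real
  assumes orthonormal: "orthonormal_on {\<alpha>. length \<alpha> \<le> N} e" and s_nonneg: "0 \<le> s"
begin

definition creation :: "'n \<Rightarrow> 'e \<Rightarrow>\<^sub>L 'e" where
  "creation i = finite_rank {\<alpha>. length \<alpha> < N} e (\<lambda>\<alpha>. s *\<^sub>R e (i # \<alpha>))"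

lemma finite_shorter [simp]: "finite {\<alpha> :: 'n list. length \<alpha> < N}"
proof -
  have "{\<alpha> :: 'n list. length \<alpha> < N} = (\<Union>k<N. {\<alpha>. length \<alpha> = k})"
    by auto
  then show ?thesis
    by simp
qed

lemma creation_bounded_operators: "creation i \<in> bounded_operators"
  by (simp add: creation_def finite_rank_bounded_operators)

text \<open>The adjoint of \<open>creation i\<close> reads off the coefficients of \<open>y\<close>
  at the words beginning with \<open>i\<close>. Over all letters these words are distinct, so Bessel
  bounds the total.\<close>

lemma creation_row_ball: "creation \<in> row_ball s"
proof -
  have "(\<Sum>i\<in>UNIV. (norm (cadjoint (creation i) y))\<^sup>2) \<le> s\<^sup>2 * (norm y)\<^sup>2" for y
  proof -
    have orth: "orthonormal_on {\<alpha>. length \<alpha> < N} e"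
      using orthonormal unfolding orthonormal_on_def by auto
    have "(norm (cadjoint (creation i) y))\<^sup>2
        = s\<^sup>2 * (\<Sum>\<alpha> | length \<alpha> < N. (cmod (cinner y (e (i # \<alpha>))))\<^sup>2)" for i
      unfolding creation_def cadjoint_finite_rank finite_rank_apply
      by (subst norm_orthonormal_sum[OF finite_shorter orth])
        (simp add: cinner_scaleR_right norm_mult power_mult_distrib sum_distrib_left)
    then have "(\<Sum>i\<in>UNIV. (norm (cadjoint (creation i) y))\<^sup>2)
        = s\<^sup>2 * (\<Sum>(i, \<alpha>) \<in> UNIV \<times> {\<alpha>. length \<alpha> < N}. (cmod (cinner y (e (i # \<alpha>))))\<^sup>2)"
      by (simp add: sum.cartesian_product flip: sum_distrib_left)
    also have "\<dots> \<le> s\<^sup>2 * (norm y)\<^sup>2"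
    proof (rule mult_left_mono)
      have "orthonormal_on (UNIV \<times> {\<alpha>. length \<alpha> < N}) (\<lambda>(i, \<alpha>). e (i # \<alpha>))"
        using orthonormal unfolding orthonormal_on_def by auto
      from Bessel_inequality[OF _ this, of y]
      show "(\<Sum>(i, \<alpha>) \<in> UNIV \<times> {\<alpha>. length \<alpha> < N}. (cmod (cinner y (e (i # \<alpha>))))\<^sup>2) \<le> (norm y)\<^sup>2"
        by (simp add: case_prod_beta')
    qed simp
    finally show ?thesis .
  qed
  then have "norm (\<Sum>i\<in>UNIV. creation i o\<^sub>L cadjoint (creation i)) \<le> s\<^sup>2"
    by (intro norm_sum_compose_cadjoint_le creation_bounded_operators) simp_all
  then have "sqrt (norm (\<Sum>i\<in>UNIV. creation i o\<^sub>L cadjoint (creation i))) \<le> s"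
    using s_nonneg by (intro real_le_lsqrt) simp_all
  then show ?thesis
    by (simp add: row_ball_def creation_bounded_operators)
qed

lemma creation_basis:
  assumes "length \<alpha> \<le> N"
  shows "creation i (e \<alpha>) = (if length \<alpha> < N then s *\<^sub>R e (i # \<alpha>) else 0)"
proof -
  have "creation i (e \<alpha>) = (\<Sum>\<beta> | length \<beta> < N. if \<alpha> = \<beta> then s *\<^sub>R e (i # \<beta>) else 0)"
    unfolding creation_def finite_rank_apply
    using orthonormal assms unfolding orthonormal_on_def
    by (intro sum.cong refl) (auto simp: scaleC_one)
  then show ?thesis
    by simp
qed

lemma op_word_creation:
  "op_word creation \<alpha> (e []) = (if length \<alpha> \<le> N then s ^ length \<alpha> *\<^sub>R e \<alpha> else 0)"
proof (induction \<alpha>)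
  case (Cons i \<alpha>)
  then show ?case
    by (auto simp: blinfun.scaleR_right creation_basis blinfun.zero_right)
qed simp

text \<open>Testing \<open>f(X) e []\<close> against the basis vectors of degree \<open>N\<close> recovers the coefficients.\<close>
lemma degree_norm_creation_le:
  assumes "summable (homogeneous_eval f creation)"
  shows "degree_norm f N * s ^ N \<le> norm (nc_eval f creation)"
proof -
  have coeff: "cinner (nc_eval f creation (e [])) (e \<alpha>) = of_real (s ^ N) * f \<alpha>" if "length \<alpha> = N" for \<alpha>
  proof -
    \<comment> \<open>Continuity of this functional allows it to be applied to the series term by
      term.\<close>
    have lin: "bounded_linear (\<lambda>A :: 'e \<Rightarrow>\<^sub>L 'e. cinner (A (e [])) (e \<alpha>))"
    proof (rule bounded_linear_intro[where K = "norm (e []) * norm (e \<alpha>)"])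
      show "norm (cinner (A (e [])) (e \<alpha>)) \<le> norm A * (norm (e []) * norm (e \<alpha>))" for A :: "'e \<Rightarrow>\<^sub>L 'e"
        using order_trans[OF Cauchy_Schwarz mult_right_mono[OF norm_blinfun norm_ge_zero]]
        by (simp add: mult.assoc)
    qed (simp_all add: blinfun.add_left cinner_add_left blinfun.scaleR_left cinner_scaleR_left scaleR_conv_of_real)
    \<comment> \<open>A word of degree \<open>k\<close> sends the vacuum vector \<open>e []\<close>
      to a multiple of a basis vector of degree \<open>k\<close> or to 0, so only
      \<open>k = N\<close> has a component along \<open>e \<alpha>\<close>.\<close>
    have coeff_term: "cinner (homogeneous_eval f creation k (e [])) (e \<alpha>) = (if k = N then of_real (s ^ N) * f \<alpha> else 0)" for k
    proof -
      have "cinner (homogeneous_eval f creation k (e [])) (e \<alpha>)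
          = (\<Sum>\<beta> | length \<beta> = k. if \<alpha> = \<beta> then of_real (s ^ N) * f \<alpha> else 0)"
        unfolding homogeneous_eval_def blinfun.sum_left scaleC_blinfun.rep_eq op_word_creation
          cinner_sum_left cinner_scaleC_left
        using orthonormal that unfolding orthonormal_on_def
        by (intro sum.cong refl) (auto simp: cinner_scaleR_left)
      then show ?thesis
        using that by simp
    qed
    have "cinner (nc_eval f creation (e [])) (e \<alpha>)
        = (\<Sum>k. cinner (homogeneous_eval f creation k (e [])) (e \<alpha>))"
      unfolding nc_eval_eq by (rule bounded_linear.suminf[OF lin assms])
    also have "\<dots> = of_real (s ^ N) * f \<alpha>"
      unfolding coeff_term by (subst suminf_finite[of "{N}"]) simp_all
    finally show ?thesis .
  qed
  have "(degree_norm f N * s ^ N)\<^sup>2 = (\<Sum>\<alpha> | length \<alpha> = N. (cmod (cinner (nc_eval f creation (e [])) (e \<alpha>)))\<^sup>2)"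
    using s_nonneg by (simp add: coeff degree_norm_def power_mult_distrib L2_set_power2 norm_mult norm_power
        sum_distrib_left mult.commute)
  also have "\<dots> \<le> (norm (nc_eval f creation (e [])))\<^sup>2"
    using orthonormal by (intro Bessel_inequality) (auto simp: orthonormal_on_def)
  also have "\<dots> \<le> (norm (nc_eval f creation))\<^sup>2"
  proof (rule power_mono)
    have "(norm (e []))\<^sup>2 = 1\<^sup>2"
      unfolding power2_norm_eq_cinner using orthonormal by (simp add: orthonormal_on_def)
    then have "norm (e []) = 1"
      by (rule power2_eq_imp_eq) simp_all
    then show "norm (nc_eval f creation (e [])) \<le> norm (nc_eval f creation)"
      using norm_blinfun[of "nc_eval f creation" "e []"] by simp
  qed simp
  finally show ?thesis
    by (rule power2_le_imp_le) simp
qed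

end

section \<open>The metric on free holomorphic functions\<close>

text \<open>Makes the suprema over row balls range over a nonempty set.\<close>

lemma zero_row_ball: "0 \<le> s \<Longrightarrow> (\<lambda>_. 0) \<in> row_ball s"
  by (simp add: row_ball_def blinfun_compose.zero_left)

context
  fixes s :: real
  assumes s: "0 < s" "s < 1"
begin

lemma norm_nc_eval_diff_row_ball:
  assumes "f \<in> Hol" and "g \<in> Hol" and X: "X \<in> row_ball s"
  shows "norm (nc_eval f X - nc_eval g X) \<le> (\<Sum>k. degree_norm (nc_diff f g) k * s ^ k)"
proof -
  interpret power_bounded_tuple X 1 s
    using X s by (intro row_ball_power_bounded_tuple) simp_all
  have "summable (\<lambda>k. degree_norm f k * s ^ k)" "summable (\<lambda>k. degree_norm g k * s ^ k)"
    using s assms by (simp_all add: Hol_imp_summable)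
  then show ?thesis
    using norm_nc_eval_le[of "nc_diff f g"] summable_degree_norm_diff[of f s g] s
    by (simp add: nc_eval_diff)
qed

text \<open>Guarantees that the real supremum in \<open>hol_sup_dist\<close> is a genuine least
  upper bound.\<close>

lemma bdd_above_nc_eval_diff:
  assumes "f \<in> Hol" and "g \<in> Hol"
  shows "bdd_above ((\<lambda>X. norm (nc_eval f X - nc_eval g X)) ` row_ball s)"
  using norm_nc_eval_diff_row_ball[OF assms] by (intro bdd_aboveI) blast

lemma norm_nc_eval_diff_le_hol_sup_dist:
  fixes X :: "'n::finite \<Rightarrow> 'e::complex_hilbert \<Rightarrow>\<^sub>L 'e" and E :: "'e itself"
  assumes "f \<in> Hol" and "g \<in> Hol" and "X \<in> row_ball s"
  shows "norm (nc_eval f X - nc_eval g X) \<le> hol_sup_dist E s f g"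
  unfolding hol_sup_dist_def using assms(3) bdd_above_nc_eval_diff[OF assms(1,2)] by (rule cSUP_upper)

lemma hol_sup_dist_le:
  assumes "f \<in> Hol" and "g \<in> Hol"
  shows "hol_sup_dist E s f g \<le> (\<Sum>k. degree_norm (nc_diff f g) k * s ^ k)"
  unfolding hol_sup_dist_def
  by (rule cSUP_least) (use zero_row_ball[of s] s norm_nc_eval_diff_row_ball[OF assms] in auto)

lemma hol_sup_dist_nonneg:
  fixes E :: "'e::complex_hilbert itself"
  assumes "f \<in> Hol" and "g \<in> Hol"
  shows "0 \<le> hol_sup_dist E s f g"
  by (rule order_trans[OF norm_ge_zero norm_nc_eval_diff_le_hol_sup_dist[OF assms zero_row_ball]])
    (use s in simp)

lemma hol_sup_dist_triangle:
  fixes E :: "'e::complex_hilbert itself"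
  assumes "f \<in> Hol" and "g \<in> Hol" and "h \<in> Hol"
  shows "hol_sup_dist E s f h \<le> hol_sup_dist E s f g + hol_sup_dist E s g h"
  unfolding hol_sup_dist_def[of E s f h]
proof (rule cSUP_least)
  fix X :: "'a \<Rightarrow> 'e \<Rightarrow>\<^sub>L 'e"
  assume X: "X \<in> row_ball s"
  have "norm (nc_eval f X - nc_eval h X) \<le> norm (nc_eval f X - nc_eval g X) + norm (nc_eval g X - nc_eval h X)"
    using norm_triangle_ineq[of "nc_eval f X - nc_eval g X" "nc_eval g X - nc_eval h X"] by simp
  also have "\<dots> \<le> hol_sup_dist E s f g + hol_sup_dist E s g h"
    using X assms by (intro add_mono norm_nc_eval_diff_le_hol_sup_dist)
  finally show "norm (nc_eval f X - nc_eval h X) \<le> hol_sup_dist E s f g + hol_sup_dist E s g h" .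
qed (use zero_row_ball[of s] s in auto)

text \<open>The Cauchy estimate. Infinite dimension provides room for an orthonormal family indexed
  by all words of length at most \<open>k\<close>; the resulting creation tuple is admissible in the
  supremum and detects the coefficients of degree \<open>k\<close>.\<close>

lemma degree_norm_le_hol_sup_dist:
  fixes E :: "'e::complex_hilbert itself"
  assumes inf: "infinite_dimensional E" and f: "f \<in> Hol" and g: "g \<in> Hol"
  shows "degree_norm (nc_diff f g) k * s ^ k \<le> hol_sup_dist E s f g"
proof -
  have "{\<alpha> :: 'a list. length \<alpha> \<le> k} = (\<Union>j\<le>k. {\<alpha>. length \<alpha> = j})"
    by auto
  then have "finite {\<alpha> :: 'a list. length \<alpha> \<le> k}"
    by simp
  from infinite_dimensional_imp_orthonormal[OF inf this]
  obtain e :: "'a list \<Rightarrow> 'e" where "orthonormal_on {\<alpha>. length \<alpha> \<le> k} e"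
    by blast
  then interpret truncated_creation k e s
    using s by unfold_locales simp_all
  interpret power_bounded_tuple creation 1 s
    using creation_row_ball s by (intro row_ball_power_bounded_tuple) simp_all
  have summable: "summable (\<lambda>k. degree_norm f k * s ^ k)" "summable (\<lambda>k. degree_norm g k * s ^ k)"
    using s f g by (simp_all add: Hol_imp_summable)
  have "degree_norm (nc_diff f g) k * s ^ k \<le> norm (nc_eval (nc_diff f g) creation)"
    using summable s by (intro degree_norm_creation_le summable_homogeneous_eval summable_degree_norm_diff) simp_all
  also have "\<dots> \<le> hol_sup_dist E s f g"
    using norm_nc_eval_diff_le_hol_sup_dist[OF f g creation_row_ball] nc_eval_diff[OF summable] by simp
  finally show ?thesis .
qed

end

lemma hol_sup_dist_commute: "hol_sup_dist E s f g = hol_sup_dist E s g f"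
  by (simp add: hol_sup_dist_def norm_minus_commute)

lemma divide_one_plus_mono:
  fixes a b :: real
  assumes "0 \<le> a" and "a \<le> b"
  shows "a / (1 + a) \<le> b / (1 + b)"
  using assms by (simp add: frac_le_eq divide_le_0_iff algebra_simps)

text \<open>Split the numerator and shrink each denominator. This is what carries the triangle
  inequality through the bounded transform.\<close>

lemma divide_one_plus_subadd:
  fixes a b :: real
  assumes "0 \<le> a" and "0 \<le> b"
  shows "(a + b) / (1 + (a + b)) \<le> a / (1 + a) + b / (1 + b)"
proof -
  have "a / (1 + (a + b)) \<le> a / (1 + a)" "b / (1 + (a + b)) \<le> b / (1 + b)"
    using assms by (auto intro!: divide_left_mono)
  then show ?thesis
    by (simp add: add_divide_distrib)
qed

locale hol_metric =
  fixes r :: "nat \<Rightarrow> real" and E :: "'e::complex_hilbert itself"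
  assumes radius: "0 < r m" "r m < 1" and inf: "infinite_dimensional E"
begin

definition hol_dist_term :: "('n::finite) nc_series \<Rightarrow> 'n nc_series \<Rightarrow> nat \<Rightarrow> real" where
  "hol_dist_term f g m = (1/2) ^ Suc m * (hol_sup_dist E (r m) f g / (1 + hol_sup_dist E (r m) f g))"

lemma hol_dist_eq: "f \<in> Hol \<Longrightarrow> g \<in> Hol \<Longrightarrow> hol_dist E r f g = (\<Sum>m. hol_dist_term f g m)"
  by (simp add: hol_dist_def hol_dist_term_def)

lemma hol_dist_term_nonneg: "f \<in> Hol \<Longrightarrow> g \<in> Hol \<Longrightarrow> 0 \<le> hol_dist_term f g m"
  unfolding hol_dist_term_def
  by (intro mult_nonneg_nonneg divide_nonneg_nonneg add_nonneg_nonneg hol_sup_dist_nonneg radius) simp_all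

lemma hol_dist_term_le: "f \<in> Hol \<Longrightarrow> g \<in> Hol \<Longrightarrow> hol_dist_term f g m \<le> (1/2) ^ Suc m"
  unfolding hol_dist_term_def using hol_sup_dist_nonneg[OF radius, of f g E m]
  by (intro mult_left_le) (simp_all add: divide_le_eq_1)

lemma summable_half_powers: "summable (\<lambda>m. (1/2 :: real) ^ Suc m)"
  using sums_summable[OF power_half_series] .

lemma summable_hol_dist_term:
  assumes "f \<in> Hol" and "g \<in> Hol"
  shows "summable (hol_dist_term f g)"
  by (rule summable_comparison_test'[OF summable_half_powers])
    (simp only: real_norm_def abs_of_nonneg hol_dist_term_nonneg hol_dist_term_le assms)

lemma hol_dist_term_le_hol_dist:
  assumes "f \<in> Hol" and "g \<in> Hol"
  shows "hol_dist_term f g m \<le> hol_dist E r f g"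
  using sum_le_suminf[OF summable_hol_dist_term[OF assms], of "{m}"] assms
  by (simp add: hol_dist_eq hol_dist_term_nonneg)

text \<open>A single term of the series is at most the whole, and
  \<open>t \<mapsto> t / (1 + t)\<close> is increasing; a small metric distance thus controls each
  fixed radius.\<close>

lemma hol_sup_dist_less:
  assumes "f \<in> Hol" and "g \<in> Hol" and "0 < \<epsilon>"
    and "hol_dist E r f g < (1/2) ^ Suc m * (\<epsilon> / (1 + \<epsilon>))"
  shows "hol_sup_dist E (r m) f g < \<epsilon>"
proof (rule ccontr)
  assume "\<not> ?thesis"
  then have "\<epsilon> / (1 + \<epsilon>) \<le> hol_sup_dist E (r m) f g / (1 + hol_sup_dist E (r m) f g)"
    using \<open>0 < \<epsilon>\<close> by (intro divide_one_plus_mono) simp_all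
  then have "(1/2) ^ Suc m * (\<epsilon> / (1 + \<epsilon>)) \<le> hol_dist_term f g m"
    unfolding hol_dist_term_def by (intro mult_left_mono) simp_all
  then show False
    using hol_dist_term_le_hol_dist[OF assms(1,2), of m] assms(4) by linarith
qed

text \<open>Definiteness rests on the Cauchy estimate at the single radius \<open>r 0\<close>, which
  already determines every coefficient. The triangle inequality is proved termwise.\<close>

lemma Metric_space_hol_dist: "Metric_space (Hol :: ('n::finite) nc_series set) (hol_dist E r)"
proof
  fix f g h :: "'n nc_series"
  show "0 \<le> hol_dist E r f g"
  proof (cases "f \<in> Hol \<and> g \<in> Hol")
    case True
    then show ?thesis
      by (simp add: hol_dist_eq suminf_nonneg summable_hol_dist_term hol_dist_term_nonneg)
  qed (auto simp: hol_dist_def)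
  show "hol_dist E r f g = hol_dist E r g f"
    by (auto simp: hol_dist_def hol_sup_dist_commute[of E _ f g])
  assume f: "f \<in> Hol" and g: "g \<in> Hol"
  show "hol_dist E r f g = 0 \<longleftrightarrow> f = g"
  proof
    assume "f = g"
    moreover have "hol_sup_dist E (r m) g g = 0" for m
      using hol_sup_dist_le[OF radius g g, of E m] hol_sup_dist_nonneg[OF radius g g, of E m]
      by (simp add: nc_diff_def degree_norm_def L2_set_def)
    ultimately show "hol_dist E r f g = 0"
      by (simp add: hol_dist_def)
  next
    assume "hol_dist E r f g = 0"
    then have "hol_sup_dist E (r 0) f g < \<epsilon>" if "0 < \<epsilon>" for \<epsilon>
      using that f g by (intro hol_sup_dist_less) simp_all
    then have "hol_sup_dist E (r 0) f g \<le> 0"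
      by (meson less_irrefl not_le)
    then have "degree_norm (nc_diff f g) k * r 0 ^ k \<le> 0" for k
      by (rule order_trans[OF degree_norm_le_hol_sup_dist[OF radius inf f g]])
    then have "degree_norm (nc_diff f g) k \<le> 0" for k
      using radius(1)[of 0] by (meson mult_pos_pos not_le zero_less_power)
    then have "degree_norm (nc_diff f g) (length \<alpha>) = 0" for \<alpha>
      by (intro antisym degree_norm_nonneg)
    then have "f \<alpha> = g \<alpha>" for \<alpha>
      unfolding degree_norm_def nc_diff_def by (subst (asm) L2_set_eq_0_iff) auto
    then show "f = g"
      by blast
  qed
  assume h: "h \<in> Hol"
  have "hol_dist_term f h m \<le> hol_dist_term f g m + hol_dist_term g h m" for m
  proof -
    have "hol_sup_dist E (r m) f h / (1 + hol_sup_dist E (r m) f h)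
        \<le> (hol_sup_dist E (r m) f g + hol_sup_dist E (r m) g h)
          / (1 + (hol_sup_dist E (r m) f g + hol_sup_dist E (r m) g h))"
      by (intro divide_one_plus_mono hol_sup_dist_nonneg hol_sup_dist_triangle radius f g h)
    also have "\<dots> \<le> hol_sup_dist E (r m) f g / (1 + hol_sup_dist E (r m) f g)
        + hol_sup_dist E (r m) g h / (1 + hol_sup_dist E (r m) g h)"
      by (intro divide_one_plus_subadd hol_sup_dist_nonneg radius f g h)
    finally show ?thesis
      unfolding hol_dist_term_def distrib_left[symmetric] by (intro mult_left_mono) simp_all
  qed
  then have "(\<Sum>m. hol_dist_term f h m) \<le> (\<Sum>m. hol_dist_term f g m + hol_dist_term g h m)"
    by (intro suminf_le summable_add summable_hol_dist_term f g h)
  then show "hol_dist E r f h \<le> hol_dist E r f g + hol_dist E r g h"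
    by (simp add: hol_dist_eq f g h suminf_add summable_hol_dist_term)
qed

text \<open>Converse passage, from every radius to the metric: the weights dominate the terms
  uniformly in \<open>n\<close>, so the limit may be taken inside the series.\<close>

lemma hol_dist_tendsto_0:
  assumes p: "\<And>n. p n \<in> Hol" and f: "f \<in> Hol"
    and lim: "\<And>m. (\<lambda>n. hol_sup_dist E (r m) (p n) f) \<longlonglongrightarrow> 0"
  shows "(\<lambda>n. hol_dist E r (p n) f) \<longlonglongrightarrow> 0"
proof -
  have "(\<lambda>n. hol_dist_term (p n) f m) \<longlonglongrightarrow> (1/2) ^ Suc m * (0 / (1 + 0))" for m
    unfolding hol_dist_term_def by (intro tendsto_intros lim) simp
  moreover have "eventually (\<lambda>(m, n). norm (hol_dist_term (p n) f m) \<le> (1/2) ^ Suc m) (at_top \<times>\<^sub>F sequentially)"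
    by (intro always_eventually)
      (auto simp only: split_paired_all case_prod_conv real_norm_def abs_of_nonneg
        hol_dist_term_nonneg hol_dist_term_le p f)
  ultimately show ?thesis
    using tannerys_theorem[of "\<lambda>m n. hol_dist_term (p n) f m" "\<lambda>_. 0" sequentially, OF _ _ summable_half_powers]
    by (simp add: hol_dist_eq p f)
qed

end

section \<open>Polynomials\<close>

text \<open>An arbitrary set of words is allowed so that polynomials can be built by induction, one
  word at a time.\<close>

definition nc_restrict :: "'n nc_series \<Rightarrow> 'n list set \<Rightarrow> 'n nc_series" where
  "nc_restrict f A = (\<lambda>\<alpha>. if \<alpha> \<in> A then f \<alpha> else 0)"

definition nc_monom :: "'n list \<Rightarrow> 'n nc_series" where
  "nc_monom \<alpha> = (\<lambda>\<beta>. if \<beta> = \<alpha> then 1 else 0)"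

lemma nc_restrict_Hol:
  fixes f :: "('n::finite) nc_series"
  assumes "finite A"
  shows "nc_restrict f A \<in> Hol"
proof (rule finite_degree_imp_Hol)
  fix \<alpha> :: "'n list"
  assume "(\<Sum>\<beta>\<in>A. length \<beta>) < length \<alpha>"
  then show "nc_restrict f A \<alpha> = 0"
    using assms member_le_sum[of \<alpha> A length] by (auto simp: nc_restrict_def)
qed

lemma nc_monom_Nil: "nc_monom [] = nc_one"
  by (simp add: nc_monom_def nc_one_def)

lemma nc_monom_Hol: "nc_monom \<alpha> \<in> Hol"
  by (rule finite_degree_imp_Hol[of "length \<alpha>"]) (auto simp: nc_monom_def)

lemma nc_var_Hol: "nc_var i \<in> Hol"
  using nc_monom_Hol[of "[i]"] by (simp add: nc_var_def nc_monom_def)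

lemma nc_one_Hol: "nc_one \<in> Hol"
  using nc_monom_Hol[of "[]"] by (simp add: nc_monom_Nil)

text \<open>Needed when evaluating \<open>nc_mult\<close>, because a sum over an infinite set would
  default to 0.\<close>

lemma finite_decompositions: "finite {(\<beta>, \<gamma>). \<beta> @ \<gamma> = \<alpha>}"
proof (rule finite_subset)
  show "{(\<beta>, \<gamma>). \<beta> @ \<gamma> = \<alpha>} \<subseteq> (\<lambda>j. (take j \<alpha>, drop j \<alpha>)) ` {..length \<alpha>}"
  proof clarify
    fix \<beta> \<gamma> :: "'a list"
    show "(\<beta>, \<gamma>) \<in> (\<lambda>j. (take j (\<beta> @ \<gamma>), drop j (\<beta> @ \<gamma>))) ` {..length (\<beta> @ \<gamma>)}"
      by (rule image_eqI[of _ _ "length \<beta>"]) simp_all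
  qed
qed simp

lemma nc_mult_nc_var_nc_monom: "nc_mult (nc_var i) (nc_monom \<alpha>) = nc_monom (i # \<alpha>)"
proof
  fix \<delta>
  have "nc_mult (nc_var i) (nc_monom \<alpha>) \<delta>
      = (\<Sum>p | fst p @ snd p = \<delta>. if p = ([i], \<alpha>) then 1 else 0)"
    unfolding nc_mult_def nc_var_def nc_monom_def
    by (intro sum.cong) (auto split: if_splits)
  also have "\<dots> = nc_monom (i # \<alpha>) \<delta>"
    using finite_decompositions[of \<delta>] by (auto simp: nc_monom_def case_prod_beta')
  finally show "nc_mult (nc_var i) (nc_monom \<alpha>) \<delta> = nc_monom (i # \<alpha>) \<delta>" .
qed

lemma unital_algebra_hom_nc_monom:
  assumes \<Phi>: "unital_algebra_hom \<Phi>" and T: "\<And>i. \<Phi> (nc_var i) = T i"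
  shows "\<Phi> (nc_monom \<alpha>) = op_word T \<alpha>"
proof (induction \<alpha>)
  case Nil
  show ?case
    using \<Phi> by (simp add: unital_algebra_hom_def nc_monom_Nil)
next
  case (Cons i \<alpha>)
  have "\<Phi> (nc_mult (nc_var i) (nc_monom \<alpha>)) = \<Phi> (nc_var i) o\<^sub>L \<Phi> (nc_monom \<alpha>)"
    using \<Phi> nc_var_Hol nc_monom_Hol unfolding unital_algebra_hom_def by blast
  with Cons show ?case
    by (simp add: nc_mult_nc_var_nc_monom T)
qed

lemma unital_algebra_hom_nc_restrict:
  assumes \<Phi>: "unital_algebra_hom \<Phi>" and T: "\<And>i. \<Phi> (nc_var i) = T i" and "finite A"
  shows "\<Phi> (nc_restrict f A) = (\<Sum>\<alpha>\<in>A. f \<alpha> *\<^sub>C op_word T \<alpha>)"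
  using \<open>finite A\<close>
proof (induction A rule: finite_induct)
  case empty
  \<comment> \<open>\<open>unital_algebra_hom\<close> has no clause for the zero series, so it is
    written as 0 times the unit.\<close>
  have "\<Phi> (nc_scale 0 nc_one) = 0 *\<^sub>C \<Phi> nc_one"
    using \<Phi> nc_one_Hol unfolding unital_algebra_hom_def by blast
  then have "\<Phi> (nc_restrict f {}) = 0 *\<^sub>C \<Phi> nc_one"
    by (simp add: nc_restrict_def nc_scale_def)
  also have "\<dots> = 0"
    by (rule blinfun_eqI) (simp add: scaleC_blinfun.rep_eq)
  finally show ?case
    by simp
next
  case (insert \<alpha> A)
  have "nc_restrict f (insert \<alpha> A) = nc_add (nc_scale (f \<alpha>) (nc_monom \<alpha>)) (nc_restrict f A)"
    using insert(2) by (auto simp: nc_restrict_def nc_add_def nc_scale_def nc_monom_def)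
  moreover have "nc_scale (f \<alpha>) (nc_monom \<alpha>) \<in> Hol"
    by (rule finite_degree_imp_Hol[of "length \<alpha>"]) (auto simp: nc_scale_def nc_monom_def)
  ultimately have "\<Phi> (nc_restrict f (insert \<alpha> A)) = \<Phi> (nc_scale (f \<alpha>) (nc_monom \<alpha>)) + \<Phi> (nc_restrict f A)"
    using \<Phi> nc_restrict_Hol[OF insert(1)] unfolding unital_algebra_hom_def by simp
  also have "\<Phi> (nc_scale (f \<alpha>) (nc_monom \<alpha>)) = f \<alpha> *\<^sub>C op_word T \<alpha>"
    using \<Phi> nc_monom_Hol unital_algebra_hom_nc_monom[OF \<Phi> T] unfolding unital_algebra_hom_def by metis
  finally show ?case
    using insert by simp
qed

text \<open>The strict bound matches partial sums over \<open>k < n\<close>.\<close>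

definition nc_truncate :: "nat \<Rightarrow> 'n nc_series \<Rightarrow> 'n nc_series" where
  "nc_truncate n f = nc_restrict f {\<alpha>. length \<alpha> < n}"

lemma words_less_eq_Union: "{\<alpha>. length \<alpha> < n} = (\<Union>k<n. {\<alpha>. length \<alpha> = k})"
  by auto

lemma nc_truncate_Hol: "nc_truncate n (f :: ('n::finite) nc_series) \<in> Hol"
  unfolding nc_truncate_def by (rule nc_restrict_Hol) (simp add: words_less_eq_Union)

lemma unital_algebra_hom_nc_truncate:
  fixes T :: "'n::finite \<Rightarrow> 'h::complex_hilbert \<Rightarrow>\<^sub>L 'h"
  assumes "unital_algebra_hom \<Phi>" and "\<And>i. \<Phi> (nc_var i) = T i"
  shows "\<Phi> (nc_truncate n f) = (\<Sum>k<n. homogeneous_eval f T k)"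
proof -
  have "\<Phi> (nc_truncate n f) = (\<Sum>\<alpha> | length \<alpha> < n. f \<alpha> *\<^sub>C op_word T \<alpha>)"
    unfolding nc_truncate_def
    by (rule unital_algebra_hom_nc_restrict[OF assms]) (simp_all add: words_less_eq_Union)
  also have "\<dots> = (\<Sum>k<n. homogeneous_eval f T k)"
    unfolding words_less_eq_Union homogeneous_eval_def by (rule sum.UNION_disjoint) auto
  finally show ?thesis .
qed

lemma degree_norm_truncate_diff:
  "degree_norm (nc_diff (nc_truncate n f) f) k = (if k < n then 0 else degree_norm f k)"
proof -
  have "degree_norm (nc_diff (nc_truncate n f) f) k
      = L2_set (\<lambda>\<alpha>. if k < n then 0 else cmod (f \<alpha>)) {\<alpha>. length \<alpha> = k}"
    unfolding degree_norm_def nc_diff_def nc_truncate_def nc_restrict_def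
    by (intro L2_set_cong) auto
  then show ?thesis
    by (simp add: degree_norm_def L2_set_def)
qed

text \<open>The Cauchy estimate at radius \<open>s\<close> bounds the degree \<open>k\<close>
  contribution by \<open>\<rho> * (q / s) ^ k\<close>; summing the geometric series gives the
  Lipschitz constant.\<close>

lemma (in power_bounded_tuple) norm_nc_eval_diff_le:
  fixes E :: "'e::complex_hilbert itself"
  assumes "infinite_dimensional E" and s: "q < s" "s < 1" and f: "f \<in> Hol" and g: "g \<in> Hol"
  shows "norm (nc_eval f T - nc_eval g T) \<le> C / (1 - q / s) * hol_sup_dist E s f g"
proof -
  have "0 < s"
    using q_nonneg s by simp
  define \<rho> where "\<rho> = hol_sup_dist E s f g"
  have summable: "summable (\<lambda>k. degree_norm f k * q ^ k)" "summable (\<lambda>k. degree_norm g k * q ^ k)"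
    using q_nonneg q_less_1 f g by (simp_all add: Hol_imp_summable)
  have geometric: "summable (\<lambda>k. \<rho> * (q / s) ^ k)"
    using q_nonneg s \<open>0 < s\<close> by (intro summable_mult summable_geometric) simp
  have "degree_norm (nc_diff f g) k * q ^ k \<le> \<rho> * (q / s) ^ k" for k
  proof -
    have "degree_norm (nc_diff f g) k * s ^ k * (q / s) ^ k \<le> \<rho> * (q / s) ^ k"
      unfolding \<rho>_def using q_nonneg \<open>0 < s\<close> assms
      by (intro mult_right_mono degree_norm_le_hol_sup_dist) simp_all
    then show ?thesis
      using \<open>0 < s\<close> by (simp add: power_divide)
  qed
  then have "(\<Sum>k. degree_norm (nc_diff f g) k * q ^ k) \<le> (\<Sum>k. \<rho> * (q / s) ^ k)"
    using geometric q_nonneg by (intro suminf_le summable_degree_norm_diff summable)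
  also have "\<dots> = \<rho> / (1 - q / s)"
    using q_nonneg s \<open>0 < s\<close> by (simp add: suminf_mult suminf_geometric summable_geometric)
  finally have "C * (\<Sum>k. degree_norm (nc_diff f g) k * q ^ k) \<le> C * (\<rho> / (1 - q / s))"
    using C_nonneg by (rule mult_left_mono)
  moreover have "norm (nc_eval f T - nc_eval g T) \<le> C * (\<Sum>k. degree_norm (nc_diff f g) k * q ^ k)"
    unfolding nc_eval_diff[OF summable, symmetric]
    by (intro norm_nc_eval_le summable_degree_norm_diff summable q_nonneg)
  ultimately show ?thesis
    by (simp add: \<rho>_def)
qed

context hol_metric
begin

text \<open>Truncation removes the degrees below \<open>n\<close> from the difference, so the
  distance is at most the tail of a convergent series.\<close>

lemma hol_sup_dist_nc_truncate_tendsto: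
  assumes f: "f \<in> Hol"
  shows "(\<lambda>n. hol_sup_dist E (r m) (nc_truncate n f) f) \<longlonglongrightarrow> 0"
proof (rule tendsto_sandwich[OF always_eventually always_eventually tendsto_const])
  define h where "h k = degree_norm f k * r m ^ k" for k
  have h: "summable h"
    unfolding h_def using f radius[of m] by (intro Hol_imp_summable) simp_all
  show "\<forall>n. 0 \<le> hol_sup_dist E (r m) (nc_truncate n f) f"
    by (intro allI hol_sup_dist_nonneg radius nc_truncate_Hol f)
  show "\<forall>n. hol_sup_dist E (r m) (nc_truncate n f) f \<le> suminf h - (\<Sum>k<n. h k)"
  proof
    fix n
    have "(\<lambda>k. if k \<in> {..<n} then h k else 0) sums (\<Sum>k<n. h k)"
      by (rule sums_If_finite_set) simp
    with h have "(\<lambda>k. h k - (if k \<in> {..<n} then h k else 0)) sums (suminf h - (\<Sum>k<n. h k))"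
      by (intro sums_diff summable_sums)
    then have "(\<Sum>k. h k - (if k \<in> {..<n} then h k else 0)) = suminf h - (\<Sum>k<n. h k)"
      by (rule sums_unique[symmetric])
    moreover have "(\<lambda>k. degree_norm (nc_diff (nc_truncate n f) f) k * r m ^ k)
        = (\<lambda>k. h k - (if k \<in> {..<n} then h k else 0))"
      by (auto simp: degree_norm_truncate_diff h_def)
    ultimately show "hol_sup_dist E (r m) (nc_truncate n f) f \<le> suminf h - (\<Sum>k<n. h k)"
      using hol_sup_dist_le[OF radius nc_truncate_Hol f, of E m n f] by simp
  qed
  have "(\<lambda>n. suminf h - (\<Sum>k<n. h k)) \<longlonglongrightarrow> suminf h - suminf h"
    by (intro tendsto_intros summable_LIMSEQ h)
  then show "(\<lambda>n. suminf h - (\<Sum>k<n. h k)) \<longlonglongrightarrow> 0"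
    by simp
qed

lemma nc_truncate_tendsto:
  assumes f: "f \<in> Hol"
  shows "(\<lambda>n. hol_dist E r (nc_truncate n f) f) \<longlonglongrightarrow> 0"
  by (intro hol_dist_tendsto_0 nc_truncate_Hol hol_sup_dist_nc_truncate_tendsto f)

text \<open>Translates continuity between topologies into the epsilon-delta form, used in one
  direction for existence and in the other for uniqueness.\<close>

lemma continuous_map_bounded_operators_iff:
  fixes \<Phi> :: "('n::finite) nc_series \<Rightarrow> 'h::complex_hilbert \<Rightarrow>\<^sub>L 'h"
  assumes "\<And>f. f \<in> Hol \<Longrightarrow> \<Phi> f \<in> bounded_operators"
  shows "continuous_map (Hol_topology E r) (top_of_set bounded_operators) \<Phi> \<longleftrightarrow>
    (\<forall>f\<in>Hol. \<forall>\<epsilon>>0. \<exists>\<delta>>0. \<forall>g. g \<in> Hol \<and> hol_dist E r f g < \<delta> \<longrightarrow> dist (\<Phi> f) (\<Phi> g) < \<epsilon>)"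
proof -
  interpret Hol: Metric_space "Hol :: 'n nc_series set" "hol_dist E r"
    by (rule Metric_space_hol_dist)
  show ?thesis
    using assms Hol.metric_continuous_map[OF Met_TC.Metric_space_axioms, of \<Phi>]
    by (auto simp: Hol_topology_def continuous_map_in_subtopology)
qed

end

theorem theorem5p8:
  fixes T :: "'n::finite \<Rightarrow> 'h::complex_hilbert \<Rightarrow>\<^sub>L 'h"
    and r :: "nat \<Rightarrow> real"
  assumes "\<forall>m. 0 < r m \<and> r m < 1" and "incseq r" and "r \<longlonglongrightarrow> 1"
    and "infinite_dimensional TYPE('e::complex_hilbert)"
    and "\<forall>i. T i \<in> bounded_operators"
    and "joint_spectral_radius T < 1"
  shows "continuous_unital_algebra_hom TYPE('e) r (\<lambda>f. nc_eval f T) \<and>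
         (\<forall>\<Phi> :: 'n nc_series \<Rightarrow> 'h \<Rightarrow>\<^sub>L 'h.
            continuous_unital_algebra_hom TYPE('e) r \<Phi> \<and> (\<forall>i. \<Phi> (nc_var i) = T i) \<longrightarrow>
            (\<forall>f\<in>Hol. \<Phi> f = nc_eval f T))"
proof -
  interpret hol_metric r "TYPE('e)"
    using assms(1,4) by unfold_locales simp_all
  obtain C q where C: "0 < q" "q < 1" "0 < C" "\<And>k. sqrt (word_gram T k) \<le> C * q ^ k"
    using assms(5,6) by (blast intro: joint_spectral_radius_less_1_imp_bound)
  interpret power_bounded_tuple T C q
    using C assms(5) by unfold_locales simp_all
  have "continuous_map (Hol_topology TYPE('e) r) (top_of_set bounded_operators) (\<lambda>f. nc_eval f T)"
  proof (subst continuous_map_bounded_operators_iff, goal_cases)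
    case (1 f)
    then show ?case
      using unital_algebra_hom_nc_eval by (simp add: unital_algebra_hom_def)
  next
    case 2
    \<comment> \<open>Since the radii tend to 1, one of them exceeds \<open>q\<close>; the Lipschitz
      estimate is used at that radius only.\<close>
    obtain m where m: "q < r m"
      using order_tendstoD(1)[OF assms(3) \<open>q < 1\<close>] by (auto simp: eventually_sequentially)
    define K where "K = C / (1 - q / r m)"
    have "0 < K"
      unfolding K_def using C m radius(1)[of m] by simp
    show ?case
    proof (intro ballI allI impI)
      fix f :: "'n nc_series" and \<epsilon> :: real
      assume f: "f \<in> Hol" and \<epsilon>: "0 < \<epsilon>"
      have "0 < \<epsilon> / K"
        using \<epsilon> \<open>0 < K\<close> by simp
      \<comment> \<open>The threshold is the one in \<open>hol_sup_dist_less\<close> for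
        \<open>\<epsilon> / K\<close>, where \<open>K\<close> is the Lipschitz constant.\<close>
      have "dist (nc_eval f T) (nc_eval g T) < \<epsilon>"
        if "g \<in> Hol" "hol_dist TYPE('e) r f g < (1/2) ^ Suc m * (\<epsilon> / K / (1 + \<epsilon> / K))" for g
      proof -
        have "hol_sup_dist TYPE('e) (r m) f g < \<epsilon> / K"
          using f that \<open>0 < \<epsilon> / K\<close> by (intro hol_sup_dist_less)
        then have "K * hol_sup_dist TYPE('e) (r m) f g < \<epsilon>"
          using \<open>0 < K\<close> by (simp add: field_simps)
        then show ?thesis
          using norm_nc_eval_diff_le[OF inf m radius(2) f that(1)] by (simp add: dist_norm K_def)
      qed
      moreover have "0 < (1/2) ^ Suc m * (\<epsilon> / K / (1 + \<epsilon> / K))"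
        using \<open>0 < \<epsilon> / K\<close> by (intro mult_pos_pos divide_pos_pos[of "\<epsilon> / K"] add_pos_pos) simp_all
      ultimately show "\<exists>\<delta>>0. \<forall>g. g \<in> Hol \<and> hol_dist TYPE('e) r f g < \<delta> \<longrightarrow>
          dist (nc_eval f T) (nc_eval g T) < \<epsilon>"
        by blast
    qed
  qed
  moreover have "\<Phi> f = nc_eval f T"
    if \<Phi>: "continuous_unital_algebra_hom TYPE('e) r \<Phi>" and \<Phi>T: "\<And>i. \<Phi> (nc_var i) = T i" and f: "f \<in> Hol"
    for \<Phi> :: "'n nc_series \<Rightarrow> 'h \<Rightarrow>\<^sub>L 'h" and f
  proof -
    interpret Hol: Metric_space "Hol :: 'n nc_series set" "hol_dist TYPE('e) r"
      by (rule Metric_space_hol_dist)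
    have hom: "unital_algebra_hom \<Phi>"
      using \<Phi> by (simp add: continuous_unital_algebra_hom_def)
    \<comment> \<open>Continuity gives one limit along the truncations. Their images are also the
      partial sums of the series for \<open>f(T)\<close>, which gives the other.\<close>
    have "(\<lambda>n. \<Phi> (nc_truncate n f)) \<longlonglongrightarrow> \<Phi> f"
    proof (rule metric_LIMSEQ_I)
      fix \<epsilon> :: real
      assume "0 < \<epsilon>"
      moreover have "\<forall>f\<in>Hol. \<forall>\<epsilon>>0. \<exists>\<delta>>0. \<forall>g. g \<in> Hol \<and> hol_dist TYPE('e) r f g < \<delta> \<longrightarrow> dist (\<Phi> f) (\<Phi> g) < \<epsilon>"
        using \<Phi> continuous_map_bounded_operators_iff[of \<Phi>]
        by (simp add: continuous_unital_algebra_hom_def unital_algebra_hom_def)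
      ultimately obtain \<delta> where "0 < \<delta>"
        and \<delta>: "\<And>g. g \<in> Hol \<Longrightarrow> hol_dist TYPE('e) r f g < \<delta> \<Longrightarrow> dist (\<Phi> f) (\<Phi> g) < \<epsilon>"
        using f by blast
      have "eventually (\<lambda>n. hol_dist TYPE('e) r (nc_truncate n f) f < \<delta>) sequentially"
        by (rule order_tendstoD(2)[OF nc_truncate_tendsto[OF f] \<open>0 < \<delta>\<close>])
      then show "\<exists>N. \<forall>n\<ge>N. dist (\<Phi> (nc_truncate n f)) (\<Phi> f) < \<epsilon>"
        using \<delta>[OF nc_truncate_Hol] unfolding eventually_sequentially
        by (metis Hol.commute dist_commute)
    qed
    moreover have "(\<lambda>n. \<Phi> (nc_truncate n f)) \<longlonglongrightarrow> nc_eval f T"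
      unfolding unital_algebra_hom_nc_truncate[OF hom \<Phi>T] nc_eval_eq
      using f q_nonneg q_less_1 by (intro summable_LIMSEQ summable_homogeneous_eval Hol_imp_summable)
    ultimately show ?thesis
      by (rule LIMSEQ_unique)
  qed
  ultimately show ?thesis
    using unital_algebra_hom_nc_eval by (simp add: continuous_unital_algebra_hom_def)
qed

end
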